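(* Let $\mathcal{H}$ be a complex Hilbert space and let $A,B\in\mathcal{B}(\mathcal{H})$. Then, for each choice of the sign $\pm$ and for all $t\in[0,1]$, $$w(AB\pm BA)\leq\frac12\left\||A|^{2t}+|B^*|^{2(1-t)}\right\|\left\||B|^{2t}+|A^*|^{2(1-t)}\right\|.$$ In particular, for $t=\frac12$, $$w(AB\pm BA)\leq\frac12\left\||A|+|B^*|\right\|\left\||B|+|A^*|\right\|.$$
   Context: $\mathcal{B}(\mathcal{H})$ is the algebra of bounded linear operators on $\mathcal{H}$ with operator norm $\|\cdot\|$. For $A\in\mathcal{B}(\mathcal{H})$, $|A|=(A^*A)^{1/2}$ and $|A^*|=(AA^* )^{1/2}$, and the numerical radius is $w(A)=\sup\{|\langle Ax,x\rangle|: x\in\mathcal{H},\ \|x\|=1\}$. Powers of positive operators are given by the continuous functional calculus, with the zeroth power of any positive operator equal to the identity $I$. *)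

theory Defs
  imports "HOL-Analysis.Analysis" "HOL-Computational_Algebra.Polynomial"
begin

text \<open>
  A complex Hilbert space, presented as the complete real inner product space underlying it
  together with the complex scalar multiplication and the complex inner product.  The norm is the
  usual one, because \<open>norm x = sqrt (inner x x) = sqrt (Re (cinner x x))\<close>.
\<close>

class complex_hilbert_space = real_inner + complete_space +
  fixes scaleC :: "complex \<Rightarrow> 'a \<Rightarrow> 'a"  (infixr "*\<^sub>C" 75)
    and cinner :: "'a \<Rightarrow> 'a \<Rightarrow> complex"
  assumes scaleC_add_right: "a *\<^sub>C (x + y) = a *\<^sub>C x + a *\<^sub>C y"
    and scaleC_add_left: "(a + b) *\<^sub>C x = a *\<^sub>C x + b *\<^sub>C x"
    and scaleC_scaleC: "a *\<^sub>C b *\<^sub>C x = (a * b) *\<^sub>C x"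
    and scaleC_complex_of_real: "complex_of_real r *\<^sub>C x = r *\<^sub>R x"
    and cinner_commute: "cinner x y = cnj (cinner y x)"
    and cinner_add_left: "cinner (x + y) z = cinner x z + cinner y z"
    and cinner_scaleC_left: "cinner (a *\<^sub>C x) y = a * cinner x y"
    and Re_cinner: "Re (cinner x y) = inner x y"

text \<open>
  The elements of \<open>B(H)\<close> are the complex-linear members of \<^typ>\<open>'a \<Rightarrow>\<^sub>L 'a\<close>; the norm of that type
  is the operator norm.
\<close>

definition clinear_op :: "('a::complex_hilbert_space \<Rightarrow>\<^sub>L 'a) \<Rightarrow> bool" where
  "clinear_op A \<longleftrightarrow> (\<forall>c x. A (c *\<^sub>C x) = c *\<^sub>C A x)"

definition adj :: "('a::complex_hilbert_space \<Rightarrow>\<^sub>L 'a) \<Rightarrow> ('a \<Rightarrow>\<^sub>L 'a)" where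
  "adj A = (THE S :: 'a \<Rightarrow>\<^sub>L 'a. \<forall>x y. cinner (A x) y = cinner x (S y))"

text \<open>
  On the zero space there are no unit vectors; the supremum, taken in the nonnegative reals, is
  then \<open>0\<close>, whereas \<open>Sup {}\<close> is unspecified for type \<^typ>\<open>real\<close>.
\<close>

definition numerical_radius :: "('a::complex_hilbert_space \<Rightarrow>\<^sub>L 'a) \<Rightarrow> real" where
  "numerical_radius A =
     (if \<exists>x::'a. norm x = 1 then (SUP x\<in>{x. norm x = 1}. cmod (cinner (A x) x)) else 0)"

definition spectrum :: "('a::complex_hilbert_space \<Rightarrow>\<^sub>L 'a) \<Rightarrow> complex set" where
  "spectrum T = {z. \<not> (\<exists>S. clinear_op S \<and>
     (\<forall>x. S (T x - z *\<^sub>C x) = x \<and> T (S x) - z *\<^sub>C S x = x))}"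

definition poly_op :: "real poly \<Rightarrow> ('a::complex_hilbert_space \<Rightarrow>\<^sub>L 'a) \<Rightarrow> ('a \<Rightarrow>\<^sub>L 'a)" where
  "poly_op p T = (\<Sum>i\<le>degree p. coeff p i *\<^sub>R (((o\<^sub>L) T ^^ i) id_blinfun))"

text \<open>
  Continuous functional calculus for a self-adjoint operator \<open>T\<close> and a real function \<open>f\<close> that is
  continuous on the (real, compact) spectrum of \<open>T\<close>: \<open>f(T)\<close> is the common norm limit of \<open>p\<^sub>n(T)\<close>
  over all sequences of polynomials \<open>p\<^sub>n\<close> that converge to \<open>f\<close> uniformly on the spectrum.
\<close>

definition cfc :: "(real \<Rightarrow> real) \<Rightarrow> ('a::complex_hilbert_space \<Rightarrow>\<^sub>L 'a) \<Rightarrow> ('a \<Rightarrow>\<^sub>L 'a)" where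
  "cfc f T = (THE S. \<forall>p :: nat \<Rightarrow> real poly.
     uniform_limit {r. complex_of_real r \<in> spectrum T} (\<lambda>n. poly (p n)) f sequentially \<longrightarrow>
     (\<lambda>n. poly_op (p n) T) \<longlonglongrightarrow> S)"

text \<open>
  The case distinction makes the zeroth power the identity also when \<open>0\<close> is in the spectrum,
  since \<open>0 powr 0 = 0\<close>.
\<close>

definition op_powr :: "('a::complex_hilbert_space \<Rightarrow>\<^sub>L 'a) \<Rightarrow> real \<Rightarrow> ('a \<Rightarrow>\<^sub>L 'a)" where
  "op_powr T s = cfc (\<lambda>r. if s = 0 then 1 else r powr s) T"

definition op_abs :: "('a::complex_hilbert_space \<Rightarrow>\<^sub>L 'a) \<Rightarrow> ('a \<Rightarrow>\<^sub>L 'a)" where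
  "op_abs A = op_powr (adj A o\<^sub>L A) (1/2)"

end

(*
  With f(r) = r^t and g(r) = r^(1-t), Kato's mixed Schwarz inequality
  |<A u, v>| <= |f(|A|) u| |g(|A*|) v|, used once for A and once for B, gives
    |<A B x, x>| <= |g(|B*|) f(|A|)| |f(|B|) x| |g(|A*|) x|.
  The first factor is at most |f(|A|)^2 + g(|B*|)^2| / 2 and, by AM-GM, the product of the other two
  is at most |f(|B|)^2 + g(|A*|)^2| / 2 on unit vectors.  Exchanging A and B exchanges the two norms,
  so the terms AB and BA contribute a quarter of their product each.

  The functional calculus rests on |p(T)| <= sup |p| over the spectrum of a self-adjoint T:
  p(T)^2 - |p(T)|^2 is not bounded below, so one of the real linear factors of p^2 - |p(T)|^2
  vanishes at a point of the spectrum.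
*)

theory Submission
  imports Defs "HOL-Computational_Algebra.Fundamental_Theorem_Algebra"
begin

text \<open>\<open>cfc\<close> is a definite description over all approximating polynomial
  sequences, so nothing can be said about \<open>cfc f T\<close> until a limit exists and is known
  not to depend on the sequence. The norm bound on polynomials gives both, because the difference of
  two approximants is again a polynomial. The calculus is built for positive operators, whose
  spectrum lies in [0, |T|]: a function continuous on the half-line then has approximants on a
  compact interval, and one sequence can serve several operators. This last point carries functions
  of |A| across \<open>A\<close> to functions of the absolute value of \<open>adj A\<close>, the
  replacement for a polar decomposition. Most estimates use the real inner product; complex scalars
  return by rotating a vector, to obtain the adjoint for \<open>cinner\<close> and to pass from a
  real part to a modulus.\<close>

instance complex_hilbert_space \<subseteq> banach ..

section \<open>Complex-linear and self-adjoint operators\<close>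

lemma clinear_opD: "clinear_op A \<Longrightarrow> A (c *\<^sub>C x) = c *\<^sub>C A x"
  by (simp add: clinear_op_def)

lemma scaleC_scaleR: "c *\<^sub>C (r *\<^sub>R x) = r *\<^sub>R (c *\<^sub>C x)"
  by (metis mult.commute scaleC_complex_of_real scaleC_scaleC)

lemma scaleC_zero: "c *\<^sub>C (0::'a::complex_hilbert_space) = 0"
  using scaleC_scaleR[of c 0 "0::'a"] by simp

lemma scaleC_minus: "c *\<^sub>C (- x) = - (c *\<^sub>C x)"
  using scaleC_scaleR[of c "-1" x] by simp

lemma scaleC_diff: "c *\<^sub>C (x - y) = c *\<^sub>C x - c *\<^sub>C y"
  using scaleC_add_right[of c x "- y"] by (simp add: scaleC_minus)

lemma cinner_scaleC_right: "cinner x (c *\<^sub>C y) = cnj c * cinner x y"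
  by (metis cinner_commute cinner_scaleC_left complex_cnj_mult)

lemma cinner_self: "cinner x x = complex_of_real ((norm x)\<^sup>2)"
proof -
  have "Im (cinner x x) = 0"
    by (metis cinner_commute neg_equal_zero cnj.simps(2))
  then show ?thesis
    by (simp add: complex_eq_iff Re_cinner power2_norm_eq_inner)
qed

lemma norm_scaleC: "norm (c *\<^sub>C x) = cmod c * norm x"
proof -
  have "complex_of_real ((norm (c *\<^sub>C x))\<^sup>2) = complex_of_real ((cmod c * norm x)\<^sup>2)"
    unfolding cinner_self[symmetric] cinner_scaleC_left cinner_scaleC_right
    using complex_norm_square[of c]
    by (simp add: cinner_self power_mult_distrib mult.assoc[symmetric] mult.commute[of "cnj c"])
  then show ?thesis
    by (simp only: of_real_eq_iff) (simp add: power2_eq_iff_nonneg)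
qed

lemma bounded_linear_scaleC: "bounded_linear (\<lambda>x. c *\<^sub>C x)"
  by (rule bounded_linear_intro[where K="cmod c"])
     (simp_all add: scaleC_add_right scaleC_scaleR norm_scaleC mult.commute)

lemma clinear_op_id: "clinear_op id_blinfun"
  and clinear_op_0: "clinear_op 0"
  and clinear_op_add: "clinear_op A \<Longrightarrow> clinear_op B \<Longrightarrow> clinear_op (A + B)"
  and clinear_op_scaleR: "clinear_op A \<Longrightarrow> clinear_op (r *\<^sub>R A)"
  and clinear_op_compose: "clinear_op A \<Longrightarrow> clinear_op B \<Longrightarrow> clinear_op (A o\<^sub>L B)"
  by (simp_all add: clinear_op_def blinfun.bilinear_simps scaleC_zero scaleC_add_right
      scaleC_diff scaleC_scaleR)

lemma clinear_op_tendsto: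
  assumes "\<And>n. clinear_op (S n)" "S \<longlonglongrightarrow> L"
  shows "clinear_op L"
  unfolding clinear_op_def
proof (intro allI)
  fix c x
  have lim: "(\<lambda>n. S n y) \<longlonglongrightarrow> L y" for y
    using assms(2) by (intro tendsto_intros)
  have "(\<lambda>n. S n (c *\<^sub>C x)) \<longlonglongrightarrow> c *\<^sub>C L x"
    using bounded_linear.tendsto[OF bounded_linear_scaleC lim]
    by (simp add: clinear_opD[OF assms(1)])
  then show "L (c *\<^sub>C x) = c *\<^sub>C L x"
    using LIMSEQ_unique lim by blast
qed

lemma inner_apply_le:
  fixes T :: "'a::real_inner \<Rightarrow>\<^sub>L 'a"
  shows "inner (T x) x \<le> norm T * (norm x)\<^sup>2"
proof -
  have "inner (T x) x \<le> norm (T x) * norm x" by (rule norm_cauchy_schwarz)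
  also have "\<dots> \<le> norm T * norm x * norm x" by (intro mult_right_mono norm_blinfun) simp
  finally show ?thesis by (simp add: power2_eq_square mult.assoc)
qed

text \<open>The real inner product suffices: the imaginary part of \<open>cinner\<close> is a real
  part at a rotated vector, and complex linearity moves the rotation through
  \<open>T\<close>.\<close>

definition selfadjoint :: "('a::complex_hilbert_space \<Rightarrow>\<^sub>L 'a) \<Rightarrow> bool" where
  "selfadjoint T \<longleftrightarrow> clinear_op T \<and> (\<forall>x y. inner (T x) y = inner x (T y))"

definition positive_op :: "('a::complex_hilbert_space \<Rightarrow>\<^sub>L 'a) \<Rightarrow> bool" where
  "positive_op T \<longleftrightarrow> selfadjoint T \<and> (\<forall>x. 0 \<le> inner (T x) x)"

lemma selfadjoint_clinear: "selfadjoint T \<Longrightarrow> clinear_op T"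
  and selfadjointD: "selfadjoint T \<Longrightarrow> inner (T x) y = inner x (T y)"
  by (simp_all add: selfadjoint_def)

lemma positive_op_selfadjoint: "positive_op T \<Longrightarrow> selfadjoint T"
  and positive_opD: "positive_op T \<Longrightarrow> 0 \<le> inner (T x) x"
  by (simp_all add: positive_op_def)

lemma selfadjoint_id: "selfadjoint id_blinfun"
  and selfadjoint_0: "selfadjoint 0"
  and selfadjoint_add: "selfadjoint A \<Longrightarrow> selfadjoint B \<Longrightarrow> selfadjoint (A + B)"
  and selfadjoint_scaleR: "selfadjoint A \<Longrightarrow> selfadjoint (r *\<^sub>R A)"
  by (simp_all add: selfadjoint_def clinear_op_id clinear_op_0 clinear_op_add clinear_op_scaleR
      blinfun.bilinear_simps inner_add_left inner_add_right)

lemma selfadjoint_compose: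
  "selfadjoint A \<Longrightarrow> selfadjoint B \<Longrightarrow> A o\<^sub>L B = B o\<^sub>L A \<Longrightarrow> selfadjoint (A o\<^sub>L B)"
  unfolding selfadjoint_def by (metis blinfun_apply_blinfun_compose clinear_op_compose)

lemma selfadjoint_tendsto:
  assumes "\<And>n. selfadjoint (S n)" "S \<longlonglongrightarrow> L"
  shows "selfadjoint L"
proof -
  have lim: "(\<lambda>n. S n y) \<longlonglongrightarrow> L y" for y
    using assms(2) by (intro tendsto_intros)
  have "inner (L x) y = inner x (L y)" for x y
  proof (rule LIMSEQ_unique)
    show "(\<lambda>n. inner (S n x) y) \<longlonglongrightarrow> inner (L x) y"
      by (intro tendsto_intros lim)
    show "(\<lambda>n. inner (S n x) y) \<longlonglongrightarrow> inner x (L y)"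
      unfolding selfadjointD[OF assms(1)] by (intro tendsto_intros lim)
  qed
  moreover have "clinear_op L"
    using assms clinear_op_tendsto selfadjoint_clinear by blast
  ultimately show ?thesis by (simp add: selfadjoint_def)
qed

section \<open>Polynomials of an operator\<close>

lemma poly_op_altdef:
  assumes "degree p \<le> n"
  shows "poly_op p T = (\<Sum>i\<le>n. coeff p i *\<^sub>R (((o\<^sub>L) T ^^ i) id_blinfun))"
  unfolding poly_op_def
  by (rule sum.mono_neutral_left) (use assms in \<open>auto simp: coeff_eq_0\<close>)

lemma poly_op_0: "poly_op 0 T = 0"
  by (simp add: poly_op_def)

text \<open>Horner's recursion. It reduces the algebra of \<open>poly_op\<close> to induction over
  \<open>pCons\<close>.\<close>

lemma poly_op_pCons: "poly_op (pCons a p) T = a *\<^sub>R id_blinfun + (T o\<^sub>L poly_op p T)"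
proof -
  have "poly_op (pCons a p) T
      = (\<Sum>i\<le>Suc (degree p). coeff (pCons a p) i *\<^sub>R (((o\<^sub>L) T ^^ i) id_blinfun))"
    by (rule poly_op_altdef) (rule degree_pCons_le)
  also have "\<dots> = a *\<^sub>R id_blinfun
      + (\<Sum>i\<le>degree p. coeff p i *\<^sub>R (T o\<^sub>L (((o\<^sub>L) T ^^ i) id_blinfun)))"
    by (simp add: sum.atMost_Suc_shift del: sum.atMost_Suc)
  also have "(\<Sum>i\<le>degree p. coeff p i *\<^sub>R (T o\<^sub>L (((o\<^sub>L) T ^^ i) id_blinfun)))
      = T o\<^sub>L poly_op p T"
    by (simp add: poly_op_def bounded_bilinear.sum_right[OF bounded_bilinear_blinfun_compose]
        bounded_bilinear.scaleR_right[OF bounded_bilinear_blinfun_compose])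
  finally show ?thesis .
qed

lemmas blinfun_compose_simps =
  bounded_bilinear.add_left[OF bounded_bilinear_blinfun_compose]
  bounded_bilinear.add_right[OF bounded_bilinear_blinfun_compose]
  bounded_bilinear.diff_left[OF bounded_bilinear_blinfun_compose]
  bounded_bilinear.diff_right[OF bounded_bilinear_blinfun_compose]
  bounded_bilinear.scaleR_left[OF bounded_bilinear_blinfun_compose]
  bounded_bilinear.scaleR_right[OF bounded_bilinear_blinfun_compose]
  bounded_bilinear.zero_left[OF bounded_bilinear_blinfun_compose]
  bounded_bilinear.zero_right[OF bounded_bilinear_blinfun_compose]

lemma id_blinfun_compose: "id_blinfun o\<^sub>L T = T" and compose_id_blinfun: "T o\<^sub>L id_blinfun = T"
  by (auto intro: blinfun_eqI)

lemma compose_assoc: "(R o\<^sub>L S) o\<^sub>L T = R o\<^sub>L (S o\<^sub>L T)"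
  by (auto intro: blinfun_eqI)

lemma poly_op_add: "poly_op (p + q) T = poly_op p T + poly_op q T"
  by (induction p q rule: poly_induct2)
     (simp_all add: poly_op_0 poly_op_pCons blinfun_compose_simps scaleR_add_left algebra_simps)

lemma poly_op_smult: "poly_op (smult c p) T = c *\<^sub>R poly_op p T"
  by (induction p) (simp_all add: poly_op_0 poly_op_pCons blinfun_compose_simps algebra_simps)

lemma poly_op_diff: "poly_op (p - q) T = poly_op p T - poly_op q T"
  using poly_op_add[of p "- q" T] poly_op_smult[of "-1" q T] by simp

lemma poly_op_mult: "poly_op (p * q) T = poly_op p T o\<^sub>L poly_op q T"
  by (induction p)
     (simp_all add: poly_op_0 poly_op_pCons poly_op_add poly_op_smult blinfun_compose_simps
       id_blinfun_compose compose_assoc)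

lemma poly_op_commute: "poly_op p T o\<^sub>L poly_op q T = poly_op q T o\<^sub>L poly_op p T"
  by (metis mult.commute poly_op_mult)

lemma poly_op_X: "poly_op [:0, 1:] T = T"
  by (simp add: poly_op_pCons poly_op_0 blinfun_compose_simps compose_id_blinfun)

lemma selfadjoint_poly_op: "selfadjoint T \<Longrightarrow> selfadjoint (poly_op p T)"
proof (induction p)
  case (pCons a p)
  have "T o\<^sub>L poly_op p T = poly_op p T o\<^sub>L T"
    using poly_op_commute[of "[:0, 1:]" T p] by (simp add: poly_op_X)
  with pCons show ?case
    by (simp add: poly_op_pCons selfadjoint_add selfadjoint_scaleR selfadjoint_id
        selfadjoint_compose)
qed (simp add: poly_op_0 selfadjoint_0)

lemma poly_op_intertwine:
  assumes "X o\<^sub>L S = T o\<^sub>L X"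
  shows "X o\<^sub>L poly_op p S = poly_op p T o\<^sub>L X"
proof (induction p)
  case (pCons a p)
  have "X o\<^sub>L (S o\<^sub>L poly_op p S) = (T o\<^sub>L poly_op p T) o\<^sub>L X"
    by (metis assms compose_assoc pCons.IH)
  then show ?case
    by (simp add: poly_op_pCons blinfun_compose_simps id_blinfun_compose compose_id_blinfun)
qed (simp add: poly_op_0 blinfun_compose_simps)

section \<open>The spectrum of a self-adjoint operator\<close>

text \<open>The negation says that 0 is an approximate eigenvalue. The property follows from
  invertibility and is stable under composition, so it can be checked factor by factor.\<close>

definition bounded_below :: "('a::real_normed_vector \<Rightarrow>\<^sub>L 'a) \<Rightarrow> bool" where
  "bounded_below T \<longleftrightarrow> (\<exists>m>0. \<forall>x. m * norm x \<le> norm (T x))"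

lemma bounded_below_compose:
  assumes "bounded_below S" "bounded_below T"
  shows "bounded_below (S o\<^sub>L T)"
proof -
  obtain m n where m: "m > 0" "\<And>x. m * norm x \<le> norm (S x)"
    and n: "n > 0" "\<And>x. n * norm x \<le> norm (T x)"
    using assms unfolding bounded_below_def by blast
  have "m * n * norm x \<le> norm (S (T x))" for x
    using order_trans[OF mult_left_mono[OF n(2)[of x]] m(2)[of "T x"]] m(1)
    by (simp add: mult.assoc)
  then show ?thesis
    unfolding bounded_below_def using m(1) n(1) by (intro exI[of _ "m * n"]) auto
qed

text \<open>Exactly the set on which \<open>cfc\<close> demands uniform convergence.\<close>

definition real_spectrum :: "('a::complex_hilbert_space \<Rightarrow>\<^sub>L 'a) \<Rightarrow> real set" where
  "real_spectrum T = {r. complex_of_real r \<in> spectrum T}"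

lemma bounded_below_linear_factor:
  fixes T :: "'a::complex_hilbert_space \<Rightarrow>\<^sub>L 'a"
  assumes "r \<notin> real_spectrum T"
  shows "bounded_below (poly_op [:- r, 1:] T)"
proof -
  obtain S :: "'a \<Rightarrow>\<^sub>L 'a" where S: "\<And>x. S (T x - complex_of_real r *\<^sub>C x) = x"
    using assms by (auto simp: real_spectrum_def spectrum_def)
  \<comment> \<open>Adding 1 keeps the constant positive even if \<open>S = 0\<close>, as happens on
    the zero space.\<close>
  have "norm x \<le> (norm S + 1) * norm (poly_op [:- r, 1:] T x)" for x
  proof -
    have "x = S (poly_op [:- r, 1:] T x)"
      using S[of x] by (simp add: poly_op_pCons poly_op_0 blinfun.bilinear_simps
          blinfun_compose_simps compose_id_blinfun scaleC_complex_of_real)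
    then have "norm x \<le> norm S * norm (poly_op [:- r, 1:] T x)"
      by (metis norm_blinfun)
    then show ?thesis by (simp add: distrib_right add_increasing2)
  qed
  moreover have "norm S + 1 > 0" by (simp add: add_nonneg_pos)
  ultimately show ?thesis
    unfolding bounded_below_def
    by (intro exI[of _ "inverse (norm S + 1)"]) (simp add: field_simps)
qed

text \<open>The polynomial is (X - a)^2 + b^2, the factor of the conjugate roots a + ib and a - ib.
  For self-adjoint \<open>T\<close> the square has a nonnegative quadratic form, so b^2 survives as
  a coercivity constant.\<close>

lemma bounded_below_quadratic_factor:
  assumes "selfadjoint T" "b \<noteq> 0"
  shows "bounded_below (poly_op [:a\<^sup>2 + b\<^sup>2, - 2 * a, 1:] T)"
proof -
  define R where "R = poly_op [:- a, 1:] T"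
  have R: "selfadjoint R"
    unfolding R_def by (rule selfadjoint_poly_op[OF assms(1)])
  have "[:a\<^sup>2 + b\<^sup>2, - 2 * a, 1:] = [:- a, 1:] * [:- a, 1:] + [:b\<^sup>2:]"
    by (simp add: power2_eq_square)
  then have eq: "poly_op [:a\<^sup>2 + b\<^sup>2, - 2 * a, 1:] T = (R o\<^sub>L R) + b\<^sup>2 *\<^sub>R id_blinfun"
    by (simp only: poly_op_add poly_op_mult R_def)
       (simp add: poly_op_pCons poly_op_0 blinfun_compose_simps)
  have "b\<^sup>2 * norm x \<le> norm (poly_op [:a\<^sup>2 + b\<^sup>2, - 2 * a, 1:] T x)" for x
  proof (cases "x = 0")
    case False
    have "b\<^sup>2 * norm x * norm x \<le> inner (R x) (R x) + b\<^sup>2 * inner x x"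
      by (simp add: power2_norm_eq_inner[symmetric] power2_eq_square mult.assoc)
    also have "\<dots> = inner (poly_op [:a\<^sup>2 + b\<^sup>2, - 2 * a, 1:] T x) x"
      unfolding eq by (simp add: blinfun.bilinear_simps inner_add_left selfadjointD[OF R])
    also have "\<dots> \<le> norm (poly_op [:a\<^sup>2 + b\<^sup>2, - 2 * a, 1:] T x) * norm x"
      by (rule norm_cauchy_schwarz)
    finally show ?thesis using False by simp
  qed simp
  then show ?thesis
    unfolding bounded_below_def using assms(2) by (intro exI[of _ "b\<^sup>2"]) auto
qed

text \<open>The fundamental theorem of algebra supplies a complex root z; a real z gives the linear
  factor, a nonreal z the quadratic with roots z and its conjugate. The auxiliary \<open>ev\<close>
  evaluates a real polynomial at a complex point and is shown to respect sums and products, so that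
  z can be put into a division with remainder.\<close>

lemma real_poly_factor_cases:
  fixes q :: "real poly"
  assumes "degree q \<noteq> 0"
  obtains (linear) r where "[:- r, 1:] dvd q"
  | (quadratic) a b where "b \<noteq> 0" "[:a\<^sup>2 + b\<^sup>2, - 2 * a, 1:] dvd q"
proof -
  define ev where "ev p z = poly (map_poly complex_of_real p) z" for p z
  have ev_pCons: "ev (pCons a p) z = complex_of_real a + z * ev p z" for a p z
    by (cases "a = 0 \<and> p = 0") (auto simp: ev_def map_poly_pCons)
  have ev_0: "ev 0 z = 0" for z by (simp add: ev_def)
  have ev_add: "ev (p + p') z = ev p z + ev p' z" for p p' z
    by (induction p p' rule: poly_induct2) (simp_all add: ev_0 ev_pCons algebra_simps)
  have ev_smult: "ev (smult c p) z = complex_of_real c * ev p z" for c p z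
    by (induction p) (simp_all add: ev_0 ev_pCons algebra_simps)
  have ev_mult: "ev (p * p') z = ev p z * ev p' z" for p p' z
    by (induction p) (simp_all add: ev_0 ev_pCons ev_add ev_smult algebra_simps)
  have "\<not> constant (poly (map_poly complex_of_real q))"
    using assms by (simp add: constant_degree degree_map_poly)
  then obtain z where z: "ev q z = 0"
    using fundamental_theorem_of_algebra unfolding ev_def by blast
  show thesis
  proof (cases "Im z = 0")
    case True
    then have "z = complex_of_real (Re z)" by (simp add: complex_eq_iff)
    moreover have "ev p (complex_of_real r) = complex_of_real (poly p r)" for p r
      by (induction p) (simp_all add: ev_0 ev_pCons)
    ultimately have "poly q (Re z) = 0" using z by (metis of_real_eq_0_iff)
    then show thesis using linear poly_eq_0_iff_dvd by blast
  next
    case False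
    define d where "d = [:(Re z)\<^sup>2 + (Im z)\<^sup>2, - 2 * Re z, 1:]"
    \<comment> \<open>The remainder is at most linear with real coefficients. If it vanishes at a
      nonreal point, the imaginary part kills its slope and then its constant term.\<close>
    define r where "r = q mod d"
    have "ev d z = 0"
      by (simp add: d_def ev_pCons ev_0 complex_eq_iff power2_eq_square algebra_simps)
    moreover have "q = q div d * d + r" by (simp add: r_def)
    ultimately have "ev r z = 0" using z by (metis add_0 ev_add ev_mult mult_zero_right)
    moreover have r: "r = [:coeff r 0, coeff r 1:]"
    proof -
      have "degree r < 2"
        using degree_mod_less[of d q] by (auto simp: d_def r_def)
      then show ?thesis
        by (intro poly_eqI) (auto simp: coeff_pCons coeff_eq_0 split: nat.split)
    qed
    ultimately have *: "ev [:coeff r 0, coeff r 1:] z = 0" by simp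
    then have "coeff r 1 = 0" using False by (auto simp: ev_pCons ev_0 complex_eq_iff)
    with * have "coeff r 0 = 0" by (simp add: ev_pCons ev_0)
    with \<open>coeff r 1 = 0\<close> r have "r = 0" by simp
    then have "d dvd q" by (simp add: r_def dvd_eq_mod_eq_0)
    then show thesis using quadratic False unfolding d_def by blast
  qed
qed

text \<open>
  Over the reals \<open>q\<close> splits into linear and definite quadratic factors; the latter are bounded
  below because \<open>T\<close> is self-adjoint.
\<close>

lemma bounded_below_poly_op:
  assumes T: "selfadjoint T" and "q \<noteq> 0" and "\<And>r. r \<in> real_spectrum T \<Longrightarrow> poly q r \<noteq> 0"
  shows "bounded_below (poly_op q T)"
  using assms(2,3)
proof (induction "degree q" arbitrary: q rule: less_induct)
  case less
  have factor: "bounded_below (poly_op q T)"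
    if "q = d * s" "degree d > 0" "bounded_below (poly_op d T)" for d s
  proof -
    have "d \<noteq> 0" "s \<noteq> 0" using that(1) less.prems(1) by auto
    then have "degree s < degree q" using that by (simp add: degree_mult_eq)
    moreover have "poly s r \<noteq> 0" if "r \<in> real_spectrum T" for r
      using less.prems(2)[OF that] \<open>q = d * s\<close> by auto
    ultimately have "bounded_below (poly_op s T)" using less.hyps \<open>s \<noteq> 0\<close> by blast
    then show ?thesis using that by (simp add: poly_op_mult bounded_below_compose)
  qed
  show ?case
  proof (cases "degree q = 0")
    case True
    then obtain c where "q = [:c:]" by (meson degree_eq_zeroE)
    with less.prems show ?thesis
      by (auto simp: bounded_below_def poly_op_pCons poly_op_0 blinfun_compose_simps
          blinfun.bilinear_simps intro!: exI[of _ "\<bar>c\<bar>"])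
  next
    case False
    then show ?thesis
    proof (cases rule: real_poly_factor_cases)
      case (linear r)
      then obtain s where s: "q = [:- r, 1:] * s" by blast
      then have "r \<notin> real_spectrum T" using less.prems(2)[of r] by auto
      then show ?thesis using factor[OF s _ bounded_below_linear_factor] by simp
    next
      case (quadratic a b)
      then obtain s where s: "q = [:a\<^sup>2 + b\<^sup>2, - 2 * a, 1:] * s" by blast
      then show ?thesis
        using factor[OF s] bounded_below_quadratic_factor[OF T quadratic(1)] by simp
    qed
  qed
qed

text \<open>A lower bound would improve the norm of \<open>S\<close>: expanding |S S x - n^2 x|^2
  and using |S S x| <= n |S x| leaves |S x|^2 <= k |x|^2 with k < n^2.\<close>

lemma not_bounded_below_square_minus_norm:
  assumes S: "selfadjoint S" and nz: "S \<noteq> 0"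
  shows "\<not> bounded_below ((S o\<^sub>L S) - (norm S)\<^sup>2 *\<^sub>R id_blinfun)"
proof
  define n where "n = norm S"
  have n: "n > 0" using nz by (simp add: n_def)
  assume "bounded_below ((S o\<^sub>L S) - (norm S)\<^sup>2 *\<^sub>R id_blinfun)"
  then obtain m where m: "m > 0" "\<And>x. m * norm x \<le> norm (S (S x) - n\<^sup>2 *\<^sub>R x)"
    by (auto simp: bounded_below_def n_def blinfun.bilinear_simps)
  define k where "k = n\<^sup>2 - m\<^sup>2 / n\<^sup>2"
  have bound: "(norm (S x))\<^sup>2 \<le> k * (norm x)\<^sup>2" for x
  proof -
    have "norm (S (S x)) \<le> n * norm (S x)" unfolding n_def by (rule norm_blinfun)
    then have SS: "(norm (S (S x)))\<^sup>2 \<le> n\<^sup>2 * (norm (S x))\<^sup>2"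
      using power_mono[of "norm (S (S x))" "n * norm (S x)" 2] by (simp add: power_mult_distrib)
    have "m\<^sup>2 * (norm x)\<^sup>2 \<le> (norm (S (S x) - n\<^sup>2 *\<^sub>R x))\<^sup>2"
      using power_mono[OF m(2)[of x], of 2] m(1) by (simp add: power_mult_distrib)
    also have "\<dots> = (norm (S (S x)))\<^sup>2 - 2 * n\<^sup>2 * (norm (S x))\<^sup>2 + n\<^sup>2 * n\<^sup>2 * (norm x)\<^sup>2"
      using selfadjointD[OF S, of "S x" x] selfadjointD[OF S, of x "S x"]
      unfolding power2_norm_eq_inner by (simp add: inner_diff_left inner_diff_right algebra_simps)
    also have "\<dots> \<le> n\<^sup>2 * (n\<^sup>2 * (norm x)\<^sup>2 - (norm (S x))\<^sup>2)"
      using SS unfolding right_diff_distrib mult.assoc by linarith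
    finally have "m\<^sup>2 / n\<^sup>2 * (norm x)\<^sup>2 \<le> n\<^sup>2 * (norm x)\<^sup>2 - (norm (S x))\<^sup>2"
      using n by (simp add: pos_divide_le_eq mult.commute)
    then show ?thesis by (simp add: k_def left_diff_distrib)
  qed
  \<comment> \<open>The sign of \<open>k\<close> is not known yet, hence the absolute value; a
    vector with \<open>S x\<close> nonzero shows below that \<open>k\<close> is positive.\<close>
  have "norm S \<le> sqrt \<bar>k\<bar>"
  proof (rule norm_blinfun_bound)
    fix x
    have "(norm (S x))\<^sup>2 \<le> \<bar>k\<bar> * (norm x)\<^sup>2"
      using bound[of x] by (meson abs_ge_self mult_right_mono order_trans zero_le_power2)
    then have "norm (S x) \<le> sqrt (\<bar>k\<bar> * (norm x)\<^sup>2)" by (rule real_le_rsqrt)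
    then show "norm (S x) \<le> sqrt \<bar>k\<bar> * norm x" by (simp add: real_sqrt_mult)
  qed simp
  moreover obtain x where "S x \<noteq> 0" using nz by (metis blinfun_eqI zero_blinfun.rep_eq)
  then have "0 < (norm (S x))\<^sup>2" by simp
  with bound[of x] have "0 < k * (norm x)\<^sup>2" by linarith
  then have "0 < k" by (simp add: zero_less_mult_iff)
  ultimately have "n \<le> sqrt k" by (simp add: n_def)
  then have "n\<^sup>2 \<le> k" using n \<open>0 < k\<close> power_mono[of n "sqrt k" 2] by simp
  moreover have "0 < m\<^sup>2 / n\<^sup>2" using m(1) n by simp
  ultimately show False by (simp add: k_def)
qed

text \<open>Ensures in the norm bound that p^2 - |p(T)|^2 is not the zero polynomial. With an empty
  spectrum the root condition would hold vacuously and T^2 - |T|^2 would be bounded below.\<close>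

lemma real_spectrum_nonempty:
  assumes T: "selfadjoint T" and "x \<noteq> (0::'a::complex_hilbert_space)"
  shows "real_spectrum (T :: 'a \<Rightarrow>\<^sub>L 'a) \<noteq> {}"
proof
  assume empty: "real_spectrum T = {}"
  have T0: "T \<noteq> 0"
  proof
    assume "T = 0"
    then have "\<not> bounded_below (poly_op [:0, 1:] T)"
      using assms(2) by (auto simp: poly_op_X bounded_below_def not_le intro!: exI[of _ x])
    then show False using bounded_below_linear_factor[of 0 T] empty by simp
  qed
  have "bounded_below (poly_op ([:0, 1:] * [:0, 1:] - [:(norm T)\<^sup>2:]) T)"
    by (rule bounded_below_poly_op[OF T]) (use empty in simp_all)
  then have "bounded_below ((T o\<^sub>L T) - (norm T)\<^sup>2 *\<^sub>R id_blinfun)"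
    unfolding poly_op_diff poly_op_mult poly_op_X
    by (simp add: poly_op_pCons poly_op_0 blinfun_compose_simps)
  then show False using not_bounded_below_square_minus_norm[OF T T0] by blast
qed

text \<open>\<open>c\<close> stands for the supremum of |p| on the spectrum. It is assumed
  nonnegative because the spectrum is empty on the zero space.\<close>

lemma norm_poly_op_le:
  assumes T: "selfadjoint T" and "c \<ge> 0" and le: "\<And>r. r \<in> real_spectrum T \<Longrightarrow> \<bar>poly p r\<bar> \<le> c"
  shows "norm (poly_op p T) \<le> c"
proof (rule ccontr)
  define S where "S = poly_op p T"
  define q where "q = p * p - [:(norm S)\<^sup>2:]"
  assume "\<not> norm (poly_op p T) \<le> c"
  then have less: "c < norm S" by (simp add: S_def)
  then have S0: "S \<noteq> 0" using \<open>c \<ge> 0\<close> by auto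
  then obtain x where "S x \<noteq> 0" by (metis blinfun_eqI zero_blinfun.rep_eq)
  then have "x \<noteq> 0" by (auto simp: blinfun.bilinear_simps)
  have root: "poly q r \<noteq> 0" if "r \<in> real_spectrum T" for r
  proof
    assume "poly q r = 0"
    then have "(poly p r)\<^sup>2 = (norm S)\<^sup>2" by (simp add: q_def power2_eq_square)
    then have "\<bar>poly p r\<bar> = norm S" by (metis abs_norm_cancel real_sqrt_abs)
    then show False using le[OF that] less by simp
  qed
  then have "q \<noteq> 0" using real_spectrum_nonempty[OF T \<open>x \<noteq> 0\<close>] by auto
  then have "bounded_below (poly_op q T)" using bounded_below_poly_op[OF T] root by blast
  then have "bounded_below ((S o\<^sub>L S) - (norm S)\<^sup>2 *\<^sub>R id_blinfun)"
    unfolding q_def poly_op_diff poly_op_mult S_def[symmetric]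
    by (simp add: poly_op_pCons poly_op_0 blinfun_compose_simps)
  moreover have "selfadjoint S" unfolding S_def by (rule selfadjoint_poly_op[OF T])
  ultimately show False using not_bounded_below_square_minus_norm S0 by blast
qed

text \<open>
  For coercive \<open>S\<close> the equation \<open>S x = y\<close> is the fixed point equation of
  \<open>x - \<epsilon> (S x - y)\<close>, a contraction for small \<open>\<epsilon> > 0\<close>.
\<close>

lemma coercive_surj:
  fixes S :: "'a::{real_inner,complete_space} \<Rightarrow>\<^sub>L 'a"
  assumes "m > 0" and coercive: "\<And>x. m * (norm x)\<^sup>2 \<le> inner (S x) x"
  shows "\<exists>x. S x = y"
proof -
  \<comment> \<open>The choice of \<open>e\<close> minimises 1 - 2 e m + e^2 M^2, and
    \<open>c\<close> is the minimum. Adding \<open>m\<close> to the norm makes \<open>M\<close>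
    positive and at least \<open>m\<close>, which puts \<open>c\<close> into [0, 1).\<close>
  define M where "M = norm S + m"
  define e where "e = m / M\<^sup>2"
  define c where "c = 1 - m\<^sup>2 / M\<^sup>2"
  have M: "M > 0" "m \<le> M" using \<open>m > 0\<close> by (auto simp: M_def add_nonneg_pos)
  have e: "e > 0" using M \<open>m > 0\<close> by (simp add: e_def)
  have c: "0 \<le> c" "c < 1" using M \<open>m > 0\<close> by (auto simp: c_def power_mono)
  have contr: "(norm (x - e *\<^sub>R S x))\<^sup>2 \<le> c * (norm x)\<^sup>2" for x
  proof -
    have "norm (S x) \<le> M * norm x"
      using norm_blinfun[of S x] \<open>m > 0\<close> by (simp add: M_def distrib_right add_increasing2)
    then have Sx: "(norm (S x))\<^sup>2 \<le> M\<^sup>2 * (norm x)\<^sup>2"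
      using power_mono[of "norm (S x)" "M * norm x" 2] by (simp add: power_mult_distrib)
    have "(norm (x - e *\<^sub>R S x))\<^sup>2 = (norm x)\<^sup>2 - 2 * e * inner (S x) x + e\<^sup>2 * (norm (S x))\<^sup>2"
      unfolding power2_norm_eq_inner
      by (simp add: inner_diff_left inner_diff_right inner_commute power2_eq_square algebra_simps)
    also have "\<dots> \<le> (norm x)\<^sup>2 - 2 * e * (m * (norm x)\<^sup>2) + e\<^sup>2 * (M\<^sup>2 * (norm x)\<^sup>2)"
      using coercive[of x] Sx e by (intro add_mono diff_mono mult_left_mono) auto
    also have "\<dots> = (1 - 2 * e * m + e\<^sup>2 * M\<^sup>2) * (norm x)\<^sup>2" by (simp add: algebra_simps)
    also have "1 - 2 * e * m + e\<^sup>2 * M\<^sup>2 = c"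
      using M by (simp add: e_def c_def power2_eq_square field_simps)
    finally show ?thesis .
  qed
  have "\<exists>!x. x - e *\<^sub>R (S x - y) = x"
  proof (rule banach_fix_type[where c = "sqrt c"])
    show "0 \<le> sqrt c" "sqrt c < 1" using c by auto
    show "\<forall>u v. dist (u - e *\<^sub>R (S u - y)) (v - e *\<^sub>R (S v - y)) \<le> sqrt c * dist u v"
    proof (intro allI)
      fix u v
      have "dist (u - e *\<^sub>R (S u - y)) (v - e *\<^sub>R (S v - y)) = norm ((u - v) - e *\<^sub>R S (u - v))"
        by (simp add: dist_norm blinfun.bilinear_simps algebra_simps)
      also have "\<dots> \<le> sqrt (c * (norm (u - v))\<^sup>2)"
        using real_le_rsqrt contr by blast
      finally show "dist (u - e *\<^sub>R (S u - y)) (v - e *\<^sub>R (S v - y)) \<le> sqrt c * dist u v"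
        by (simp add: real_sqrt_mult dist_norm)
    qed
  qed
  then show ?thesis using e by auto
qed

text \<open>The sign \<open>s\<close> treats points below and above the numerical range together.
  Coercivity gives surjectivity as well as a lower bound, hence a bounded inverse, which inherits
  complex linearity by injectivity.\<close>

lemma real_spectrum_coerciveI:
  assumes T: "clinear_op T" and "m > 0" and "s\<^sup>2 = 1"
    and coercive: "\<And>x. m * (norm x)\<^sup>2 \<le> s * inner (T x - r *\<^sub>R x) x"
  shows "r \<notin> real_spectrum T"
proof -
  define S where "S = T - r *\<^sub>R id_blinfun"
  have S: "S x = T x - r *\<^sub>R x" for x by (simp add: S_def blinfun.bilinear_simps)
  have "\<exists>x. (s *\<^sub>R S) x = y" for y
    by (rule coercive_surj[OF \<open>m > 0\<close>]) (use coercive in \<open>simp add: S blinfun.bilinear_simps\<close>)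
  then have "\<exists>x. S x = y" for y
    by (metis blinfun.scaleR_left blinfun.scaleR_right)
  then obtain R where R: "\<And>y. S (R y) = y" by metis
  have ss: "\<bar>s\<bar> = 1" using \<open>s\<^sup>2 = 1\<close> by (simp add: abs_square_eq_1)
  have below: "m * norm x \<le> norm (S x)" for x
  proof (cases "x = 0")
    case False
    have "m * (norm x)\<^sup>2 \<le> inner (s *\<^sub>R S x) x" using coercive[of x] by (simp add: S)
    also have "\<dots> \<le> norm (s *\<^sub>R S x) * norm x" by (rule norm_cauchy_schwarz)
    finally show ?thesis using False ss by (simp add: power2_eq_square)
  qed simp
  have inj: "u = v" if "S u = S v" for u v
    using below[of "u - v"] that \<open>m > 0\<close> by (simp add: blinfun.bilinear_simps mult_le_0_iff)
  have Sc: "S (c *\<^sub>C x) = c *\<^sub>C S x" for c x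
    by (simp add: S clinear_opD[OF T] scaleC_diff scaleC_scaleR)
  have "bounded_linear R"
  proof (rule bounded_linear_intro[where K = "inverse m"])
    show "R (x + y) = R x + R y" for x y by (rule inj) (simp add: R blinfun.bilinear_simps)
    show "R (a *\<^sub>R x) = a *\<^sub>R R x" for a x by (rule inj) (simp add: R blinfun.bilinear_simps)
    show "norm (R x) \<le> norm x * inverse m" for x
      using below[of "R x"] \<open>m > 0\<close> by (simp add: R field_simps)
  qed
  then have app: "Blinfun R x = R x" for x by (simp add: bounded_linear_Blinfun_apply)
  have "clinear_op (Blinfun R)"
    unfolding clinear_op_def app by (auto intro: inj simp: R Sc)
  moreover have "Blinfun R (T x - complex_of_real r *\<^sub>C x) = x
      \<and> T (Blinfun R x) - complex_of_real r *\<^sub>C Blinfun R x = x" for x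
    using inj R by (auto simp: app scaleC_complex_of_real S[symmetric])
  ultimately show ?thesis by (auto simp: real_spectrum_def spectrum_def)
qed

lemma real_spectrum_positive_op:
  assumes T: "positive_op T"
  shows "real_spectrum T \<subseteq> {0..norm T}"
proof
  fix r assume r: "r \<in> real_spectrum T"
  have cl: "clinear_op T"
    using T by (simp add: positive_op_def selfadjoint_def)
  have "0 \<le> r"
  proof (rule ccontr)
    assume "\<not> 0 \<le> r"
    then have "r \<notin> real_spectrum T"
      using positive_opD[OF T]
      by (intro real_spectrum_coerciveI[OF cl, of "- r" 1])
         (simp_all add: inner_diff_left power2_norm_eq_inner)
    then show False using r by simp
  qed
  moreover have "r \<le> norm T"
  proof (rule ccontr)
    assume "\<not> r \<le> norm T"
    moreover have "inner (T x) x \<le> norm T * inner x x" for x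
      using inner_apply_le[of T x] by (simp add: power2_norm_eq_inner)
    ultimately have "r \<notin> real_spectrum T"
      by (intro real_spectrum_coerciveI[OF cl, of "r - norm T" "-1"])
         (simp_all add: inner_diff_left power2_norm_eq_inner algebra_simps)
    then show False using r by simp
  qed
  ultimately show "r \<in> {0..norm T}" by simp
qed

section \<open>Continuous functional calculus of a positive operator\<close>

lemma uniform_limit_poly_ex:
  fixes f :: "real \<Rightarrow> real"
  assumes "continuous_on {a..b} f"
  shows "\<exists>p. uniform_limit {a..b} (\<lambda>n. poly (p n)) f sequentially"
proof -
  have "\<exists>q. \<forall>x\<in>{a..b}. \<bar>f x - poly q x\<bar> < inverse (real (Suc n))" for n
  proof -
    obtain g where g: "real_polynomial_function g"
      and close: "\<And>x. x \<in> {a..b} \<Longrightarrow> \<bar>f x - g x\<bar> < inverse (real (Suc n))"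
      using Stone_Weierstrass_real_polynomial_function[OF _ assms, of "inverse (real (Suc n))"]
      by auto
    obtain c m where "g = (\<lambda>x. \<Sum>i\<le>m. c i * x ^ i)"
      using g real_polynomial_function_iff_sum by blast
    then have "g x = poly (\<Sum>i\<le>m. monom (c i) i) x" for x
      by (simp add: poly_sum poly_monom)
    with close show ?thesis by metis
  qed
  then obtain p where p: "\<And>n x. x \<in> {a..b} \<Longrightarrow> \<bar>f x - poly (p n) x\<bar> < inverse (real (Suc n))"
    by metis
  have "uniform_limit {a..b} (\<lambda>n. poly (p n)) f sequentially"
  proof (rule uniform_limitI)
    fix e :: real assume "e > 0"
    have "\<forall>\<^sub>F n in sequentially. inverse (real (Suc n)) < e"
      using order_tendstoD(2)[OF LIMSEQ_inverse_real_of_nat \<open>e > 0\<close>] .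
    then show "\<forall>\<^sub>F n in sequentially. \<forall>x\<in>{a..b}. dist (poly (p n) x) (f x) < e"
    proof eventually_elim
      case (elim n)
      then show ?case using p[of _ n] by (fastforce simp: dist_real_def abs_minus_commute)
    qed
  qed
  then show ?thesis by blast
qed

lemma norm_poly_op_diff_le:
  assumes "selfadjoint T" "e \<ge> 0"
    and "\<forall>r\<in>real_spectrum T. dist (poly p r) (f r) < e"
    and "\<forall>r\<in>real_spectrum T. dist (poly q r) (f r) < e"
  shows "norm (poly_op p T - poly_op q T) \<le> 2 * e"
  unfolding poly_op_diff[symmetric]
proof (rule norm_poly_op_le[OF assms(1)])
  fix r assume "r \<in> real_spectrum T"
  with assms(3,4) have "\<bar>poly p r - f r\<bar> < e" "\<bar>poly q r - f r\<bar> < e"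
    by (auto simp: dist_real_def)
  then show "\<bar>poly (p - q) r\<bar> \<le> 2 * e" by simp
qed (use assms(2) in simp)

text \<open>Justifies the definite description in \<open>cfc\<close>. A Weierstrass sequence
  \<open>p0\<close> has a Cauchy image by the norm bound, and any other admissible sequence has the
  same limit. The existence of \<open>p0\<close> also gives uniqueness, since otherwise the
  condition on the limit could be vacuous.\<close>

lemma poly_op_tendsto_cfc:
  assumes T: "positive_op T" and f: "continuous_on {0..} f"
    and p: "uniform_limit (real_spectrum T) (\<lambda>n. poly (p n)) f sequentially"
  shows "(\<lambda>n. poly_op (p n) T) \<longlonglongrightarrow> cfc f T"
proof -
  let ?U = "\<lambda>p. uniform_limit (real_spectrum T) (\<lambda>n. poly (p n)) f sequentially"
  have sa: "selfadjoint T" using T by (rule positive_op_selfadjoint)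
  have "continuous_on {0..norm T} f" using f by (rule continuous_on_subset) auto
  from uniform_limit_poly_ex[OF this]
  obtain p0 where "uniform_limit {0..norm T} (\<lambda>n. poly (p0 n)) f sequentially" by blast
  then have p0: "?U p0"
    using real_spectrum_positive_op[OF T] by (rule uniform_limit_on_subset)
  have "Cauchy (\<lambda>n. poly_op (p0 n) T)"
  proof (rule metric_CauchyI)
    fix e :: real assume "e > 0"
    then obtain N where "\<And>n. n \<ge> N \<Longrightarrow> \<forall>r\<in>real_spectrum T. dist (poly (p0 n) r) (f r) < e / 3"
      using uniform_limitD[OF p0, of "e / 3"] by (auto simp: eventually_sequentially)
    then have "dist (poly_op (p0 m) T) (poly_op (p0 n) T) < e" if "m \<ge> N" "n \<ge> N" for m n
      using norm_poly_op_diff_le[OF sa, of "e / 3" "p0 m" f "p0 n"] \<open>e > 0\<close> that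
      by (force simp: dist_norm)
    then show "\<exists>M. \<forall>m\<ge>M. \<forall>n\<ge>M. dist (poly_op (p0 m) T) (poly_op (p0 n) T) < e" by blast
  qed
  then obtain S0 where S0: "(\<lambda>n. poly_op (p0 n) T) \<longlonglongrightarrow> S0"
    using Cauchy_convergent_iff convergent_def by blast
  have lim: "(\<lambda>n. poly_op (q n) T) \<longlonglongrightarrow> S0" if q: "?U q" for q
  proof -
    have "(\<lambda>n. poly_op (q n) T - poly_op (p0 n) T) \<longlonglongrightarrow> 0"
    proof (rule tendstoI)
      fix e :: real assume "e > 0"
      then have "\<forall>\<^sub>F n in sequentially. \<forall>r\<in>real_spectrum T. dist (poly (q n) r) (f r) < e / 3"
        "\<forall>\<^sub>F n in sequentially. \<forall>r\<in>real_spectrum T. dist (poly (p0 n) r) (f r) < e / 3"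
        using uniform_limitD[OF p0, of "e / 3"] uniform_limitD[OF q, of "e / 3"] by auto
      then show "\<forall>\<^sub>F n in sequentially. dist (poly_op (q n) T - poly_op (p0 n) T) 0 < e"
      proof eventually_elim
        case (elim n)
        then show ?case
          using norm_poly_op_diff_le[OF sa, of "e / 3" "q n" f "p0 n"] \<open>e > 0\<close> by simp
      qed
    qed
    from tendsto_add[OF this S0] show ?thesis by simp
  qed
  have "cfc f T = S0"
    unfolding cfc_def real_spectrum_def[symmetric]
  proof (rule the_equality)
    show "\<forall>p. ?U p \<longrightarrow> (\<lambda>n. poly_op (p n) T) \<longlonglongrightarrow> S0" using lim by blast
    fix S assume "\<forall>p. ?U p \<longrightarrow> (\<lambda>n. poly_op (p n) T) \<longlonglongrightarrow> S"
    then show "S = S0" using p0 S0 LIMSEQ_unique by blast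
  qed
  with lim[OF p] show ?thesis by simp
qed

text \<open>The sequence depends only on \<open>f\<close> and \<open>M\<close>, so it can be applied
  to two operators simultaneously, as intertwining requires.\<close>

lemma cfc_approx:
  assumes "continuous_on {0..} f"
  obtains p where "uniform_limit {0..M} (\<lambda>n. poly (p n)) f sequentially"
    and "\<And>T :: 'a::complex_hilbert_space \<Rightarrow>\<^sub>L 'a. positive_op T \<Longrightarrow> norm T \<le> M
      \<Longrightarrow> (\<lambda>n. poly_op (p n) T) \<longlonglongrightarrow> cfc f T"
proof -
  have "continuous_on {0..M} f" using assms by (rule continuous_on_subset) auto
  from uniform_limit_poly_ex[OF this]
  obtain p where p: "uniform_limit {0..M} (\<lambda>n. poly (p n)) f sequentially" by blast
  have "(\<lambda>n. poly_op (p n) T) \<longlonglongrightarrow> cfc f T"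
    if "positive_op T" "norm T \<le> M" for T :: "'a \<Rightarrow>\<^sub>L 'a"
    using that real_spectrum_positive_op[OF that(1)]
    by (intro poly_op_tendsto_cfc[OF that(1) assms] uniform_limit_on_subset[OF p]) auto
  with p show thesis using that by blast
qed

lemma cfc_cong:
  assumes "positive_op T" "\<And>r. r \<ge> 0 \<Longrightarrow> f r = g r"
  shows "cfc f T = cfc g T"
proof -
  have "uniform_limit (real_spectrum T) (\<lambda>n. poly (p n)) f sequentially
      \<longleftrightarrow> uniform_limit (real_spectrum T) (\<lambda>n. poly (p n)) g sequentially" for p
    by (rule uniform_limit_cong') (use real_spectrum_positive_op[OF assms(1)] assms(2) in auto)
  then show ?thesis unfolding cfc_def real_spectrum_def by simp
qed

lemma cfc_poly:
  assumes "positive_op T" "\<And>r. r \<ge> 0 \<Longrightarrow> f r = poly p r"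
  shows "cfc f T = poly_op p T"
proof -
  have "(\<lambda>n::nat. poly_op p T) \<longlonglongrightarrow> cfc (poly p) T"
    by (rule poly_op_tendsto_cfc[OF assms(1)])
       (auto intro!: uniform_limitI continuous_intros)
  then have "cfc (poly p) T = poly_op p T" using LIMSEQ_unique tendsto_const by blast
  then show ?thesis using cfc_cong[OF assms] by simp
qed

lemma cfc_id: "positive_op T \<Longrightarrow> cfc (\<lambda>r. r) T = T"
  using cfc_poly[of T "\<lambda>r. r" "[:0, 1:]"] by (simp add: poly_op_X)

lemma cfc_const: "positive_op T \<Longrightarrow> cfc (\<lambda>_. c) T = c *\<^sub>R id_blinfun"
  using cfc_poly[of T "\<lambda>_. c" "[:c:]"]
  by (simp add: poly_op_pCons poly_op_0 blinfun_compose_simps)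

lemma
  fixes p q :: "'a::comm_ring poly"
  shows poly_mult_fun: "poly (p * q) = (\<lambda>x. poly p x * poly q x)"
  and poly_diff_fun: "poly (p - q) = (\<lambda>x. poly p x - poly q x)"
  by (simp_all add: fun_eq_iff)

lemma cfc_mult:
  assumes T: "positive_op T" and f: "continuous_on {0..} f" and g: "continuous_on {0..} g"
  shows "cfc (\<lambda>r. f r * g r) T = cfc f T o\<^sub>L cfc g T"
proof -
  obtain p where p: "uniform_limit {0..norm T} (\<lambda>n. poly (p n)) f sequentially"
    "(\<lambda>n. poly_op (p n) T) \<longlonglongrightarrow> cfc f T"
    using cfc_approx[OF f, of "norm T"] T by blast
  obtain q where q: "uniform_limit {0..norm T} (\<lambda>n. poly (q n)) g sequentially"
    "(\<lambda>n. poly_op (q n) T) \<longlonglongrightarrow> cfc g T"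
    using cfc_approx[OF g, of "norm T"] T by blast
  \<comment> \<open>Uniform convergence passes to products because both limits are bounded.\<close>
  have "bounded (f ` {0..norm T})" "bounded (g ` {0..norm T})"
    using continuous_on_subset[OF f, of "{0..norm T}"] continuous_on_subset[OF g, of "{0..norm T}"]
    by (auto intro!: compact_imp_bounded compact_continuous_image)
  then have "uniform_limit {0..norm T} (\<lambda>n. poly (p n * q n)) (\<lambda>r. f r * g r) sequentially"
    unfolding poly_mult_fun by (intro uniform_lim_mult p q)
  then have "(\<lambda>n. poly_op (p n * q n) T) \<longlonglongrightarrow> cfc (\<lambda>r. f r * g r) T"
    using real_spectrum_positive_op[OF T]
    by (intro poly_op_tendsto_cfc T continuous_intros f g) (rule uniform_limit_on_subset)
  moreover have "(\<lambda>n. poly_op (p n * q n) T) \<longlonglongrightarrow> (cfc f T o\<^sub>L cfc g T)"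
    unfolding poly_op_mult by (intro tendsto_intros p q)
  ultimately show ?thesis using LIMSEQ_unique by blast
qed

lemma cfc_diff:
  assumes T: "positive_op T" and f: "continuous_on {0..} f" and g: "continuous_on {0..} g"
  shows "cfc (\<lambda>r. f r - g r) T = cfc f T - cfc g T"
proof -
  obtain p where p: "uniform_limit {0..norm T} (\<lambda>n. poly (p n)) f sequentially"
    "(\<lambda>n. poly_op (p n) T) \<longlonglongrightarrow> cfc f T"
    using cfc_approx[OF f, of "norm T"] T by blast
  obtain q where q: "uniform_limit {0..norm T} (\<lambda>n. poly (q n)) g sequentially"
    "(\<lambda>n. poly_op (q n) T) \<longlonglongrightarrow> cfc g T"
    using cfc_approx[OF g, of "norm T"] T by blast
  have "uniform_limit {0..norm T} (\<lambda>n. poly (p n - q n)) (\<lambda>r. f r - g r) sequentially"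
    unfolding poly_diff_fun by (intro uniform_limit_minus p q)
  then have "(\<lambda>n. poly_op (p n - q n) T) \<longlonglongrightarrow> cfc (\<lambda>r. f r - g r) T"
    using real_spectrum_positive_op[OF T]
    by (intro poly_op_tendsto_cfc T continuous_intros f g) (rule uniform_limit_on_subset)
  moreover have "(\<lambda>n. poly_op (p n - q n) T) \<longlonglongrightarrow> cfc f T - cfc g T"
    unfolding poly_op_diff by (intro tendsto_intros p q)
  ultimately show ?thesis using LIMSEQ_unique by blast
qed

lemma selfadjoint_cfc:
  assumes T: "positive_op T" and f: "continuous_on {0..} f"
  shows "selfadjoint (cfc f T)"
proof -
  obtain p where p: "(\<lambda>n. poly_op (p n) T) \<longlonglongrightarrow> cfc f T"
    using cfc_approx[OF f, of "norm T"] T by blast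
  show ?thesis
    by (rule selfadjoint_tendsto[OF _ p])
       (intro selfadjoint_poly_op positive_op_selfadjoint[OF T])
qed

text \<open>By multiplicativity f(T) is the square of the self-adjoint operator obtained from the
  root of \<open>f\<close>.\<close>

lemma positive_op_cfc:
  assumes T: "positive_op T" and f: "continuous_on {0..} f" and nonneg: "\<And>r. r \<ge> 0 \<Longrightarrow> 0 \<le> f r"
  shows "positive_op (cfc f T)"
proof -
  define R where "R = cfc (\<lambda>r. sqrt (f r)) T"
  have cont: "continuous_on {0..} (\<lambda>r. sqrt (f r))" by (intro continuous_intros f)
  have "cfc f T = cfc (\<lambda>r. sqrt (f r) * sqrt (f r)) T"
    by (rule cfc_cong[OF T]) (simp add: nonneg)
  also have "\<dots> = R o\<^sub>L R" unfolding R_def by (rule cfc_mult[OF T cont cont])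
  finally have RR: "cfc f T = R o\<^sub>L R" .
  have R: "selfadjoint R" unfolding R_def by (rule selfadjoint_cfc[OF T cont])
  have "0 \<le> inner (cfc f T x) x" for x
    using selfadjointD[OF R, of "R x" x] by (simp add: RR)
  then show ?thesis
    unfolding positive_op_def using selfadjoint_cfc[OF T f] by blast
qed

text \<open>True for polynomials by induction; common approximants on an interval containing both
  spectra carry it to the limit.\<close>

lemma cfc_intertwine:
  fixes X :: "'a::complex_hilbert_space \<Rightarrow>\<^sub>L 'a"
  assumes "positive_op S" "positive_op T" and f: "continuous_on {0..} f"
    and X: "X o\<^sub>L S = T o\<^sub>L X"
  shows "X o\<^sub>L cfc f S = cfc f T o\<^sub>L X"
proof -
  obtain p where "(\<lambda>n. poly_op (p n) S) \<longlonglongrightarrow> cfc f S" "(\<lambda>n. poly_op (p n) T) \<longlonglongrightarrow> cfc f T"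
    using cfc_approx[OF f, of "max (norm S) (norm T)"] assms(1,2) by (metis max.cobounded1 max.cobounded2)
  then have "(\<lambda>n. X o\<^sub>L poly_op (p n) S) \<longlonglongrightarrow> (X o\<^sub>L cfc f S)"
    "(\<lambda>n. poly_op (p n) T o\<^sub>L X) \<longlonglongrightarrow> (cfc f T o\<^sub>L X)"
    by (auto intro!: tendsto_intros)
  then show ?thesis
    using LIMSEQ_unique unfolding poly_op_intertwine[OF X] by blast
qed

text \<open>The squared norm |h(T) x|^2 is the quadratic form of h^2(T) at x, and g^2 - f^2 is
  nonnegative on the half-line.\<close>

lemma norm_cfc_mono:
  assumes T: "positive_op T" and f: "continuous_on {0..} f" and g: "continuous_on {0..} g"
    and le: "\<And>r. r \<ge> 0 \<Longrightarrow> \<bar>f r\<bar> \<le> g r"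
  shows "norm (cfc f T x) \<le> norm (cfc g T x)"
proof -
  have sq: "(norm (cfc h T x))\<^sup>2 = inner (cfc (\<lambda>r. h r * h r) T x) x"
    if "continuous_on {0..} h" for h
    by (simp add: cfc_mult[OF T that that] selfadjointD[OF selfadjoint_cfc[OF T that]]
        power2_norm_eq_inner)
  have "positive_op (cfc (\<lambda>r. g r * g r - f r * f r) T)"
  proof (rule positive_op_cfc[OF T])
    show "0 \<le> g r * g r - f r * f r" if "r \<ge> 0" for r
      using power_mono[OF le[OF that], of 2] by (simp add: power2_eq_square)
  qed (intro continuous_intros f g)
  then have "0 \<le> inner (cfc (\<lambda>r. g r * g r - f r * f r) T x) x" by (rule positive_opD)
  also have "\<dots> = (norm (cfc g T x))\<^sup>2 - (norm (cfc f T x))\<^sup>2"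
    unfolding sq[OF f] sq[OF g]
    by (subst cfc_diff[OF T])
       (auto intro!: continuous_intros f g simp: blinfun.bilinear_simps inner_diff_left)
  finally have "(norm (cfc f T x))\<^sup>2 \<le> (norm (cfc g T x))\<^sup>2" by simp
  then show ?thesis by (rule power2_le_imp_le) simp
qed

section \<open>Adjoints\<close>

text \<open>The representing vector is a multiple of the point \<open>z\<close> of least norm on the
  hyperplane where \<open>\<phi>\<close> equals 1; the distance \<open>d\<close> of that hyperplane
  from the origin is the inverse of the norm of \<open>\<phi>\<close>.\<close>

lemma riesz_representation:
  fixes \<phi> :: "'a::{real_inner,complete_space} \<Rightarrow>\<^sub>L real"
  shows "\<exists>z. \<forall>x. \<phi> x = inner x z"
proof (cases "\<phi> = 0")
  case True
  then show ?thesis by (auto intro: exI[of _ 0])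
next
  case False
  define d where "d = inverse (norm \<phi>)"
  have d: "d > 0" using False by (simp add: d_def)
  have lower: "d \<le> norm y" if "\<phi> y = 1" for y
    using norm_blinfun[of \<phi> y] that False by (simp add: d_def field_simps)
  have "\<exists>y. \<phi> y = 1 \<and> norm y < d + inverse (real (Suc n))" for n
  proof -
    \<comment> \<open>As 1/b is smaller than the norm of \<open>\<phi>\<close>, some
      \<open>x\<close> violates the bound 1/b; scaled to value 1, it has norm below
      \<open>b\<close>.\<close>
    define b where "b = d + inverse (real (Suc n))"
    have b: "b > d" by (simp add: b_def)
    have "\<not> norm \<phi> \<le> inverse b"
      using less_imp_inverse_less[OF b d] by (simp add: d_def)
    moreover have "0 \<le> inverse b" using b d by simp
    ultimately obtain x where x: "inverse b * norm x < norm (\<phi> x)"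
      by (meson norm_blinfun_bound not_le)
    have "\<phi> x \<noteq> 0"
    proof
      assume "\<phi> x = 0"
      with x have "inverse b * norm x < 0" by simp
      moreover have "0 \<le> inverse b * norm x" using b d by simp
      ultimately show False by simp
    qed
    then have "\<phi> (inverse (\<phi> x) *\<^sub>R x) = 1" "norm (inverse (\<phi> x) *\<^sub>R x) < b"
      using x b d by (auto simp: blinfun.bilinear_simps field_simps)
    then show ?thesis unfolding b_def by blast
  qed
  then obtain y where y: "\<And>n. \<phi> (y n) = 1" "\<And>n. norm (y n) < d + inverse (real (Suc n))"
    by metis
  have norm_y: "(\<lambda>n. norm (y n)) \<longlonglongrightarrow> d"
  proof (rule tendsto_sandwich)
    show "\<forall>\<^sub>F n in sequentially. d \<le> norm (y n)" using lower y(1) by simp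
    show "\<forall>\<^sub>F n in sequentially. norm (y n) \<le> d + inverse (real (Suc n))"
      by (intro always_eventually allI less_imp_le y)
    show "(\<lambda>n. d + inverse (real (Suc n))) \<longlonglongrightarrow> d"
      using tendsto_add[OF tendsto_const[of d] LIMSEQ_inverse_real_of_nat] by simp
  qed simp
  have "Cauchy y"
  proof (rule metric_CauchyI)
    fix e :: real assume "e > 0"
    have "(\<lambda>n. (norm (y n))\<^sup>2) \<longlonglongrightarrow> d\<^sup>2" by (intro tendsto_intros norm_y)
    then have "\<forall>\<^sub>F n in sequentially. (norm (y n))\<^sup>2 < d\<^sup>2 + e\<^sup>2 / 4"
      by (rule order_tendstoD) (use \<open>e > 0\<close> in simp)
    then obtain N where N: "\<And>n. n \<ge> N \<Longrightarrow> (norm (y n))\<^sup>2 < d\<^sup>2 + e\<^sup>2 / 4"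
      by (auto simp: eventually_sequentially)
    have "dist (y m) (y n) < e" if "m \<ge> N" "n \<ge> N" for m n
    proof -
      \<comment> \<open>The midpoint stays on the hyperplane, so its norm is at least
        \<open>d\<close>. The parallelogram law turns the two margins e^2/4 into e^2.\<close>
      have "\<phi> ((1/2) *\<^sub>R (y m + y n)) = 1" by (simp add: blinfun.bilinear_simps y(1))
      from lower[OF this] have "2 * d \<le> norm (y m + y n)" by simp
      then have "4 * d\<^sup>2 \<le> (norm (y m + y n))\<^sup>2"
        using power_mono[of "2 * d" "norm (y m + y n)" 2] d by (simp add: power_mult_distrib)
      moreover have "(norm (y m - y n))\<^sup>2 + (norm (y m + y n))\<^sup>2
          = 2 * (norm (y m))\<^sup>2 + 2 * (norm (y n))\<^sup>2"
        unfolding power2_norm_eq_inner by (simp add: inner_simps inner_commute)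
      ultimately have "(norm (y m - y n))\<^sup>2 < e\<^sup>2"
        using N[OF that(1)] N[OF that(2)] by (simp add: field_simps)
      then show ?thesis using \<open>e > 0\<close> by (simp add: dist_norm power_less_imp_less_base)
    qed
    then show "\<exists>M. \<forall>m\<ge>M. \<forall>n\<ge>M. dist (y m) (y n) < e" by blast
  qed
  then obtain z where z: "y \<longlonglongrightarrow> z"
    using Cauchy_convergent_iff convergent_def by blast
  have norm_z: "norm z = d"
    using LIMSEQ_unique[OF tendsto_norm[OF z] norm_y] .
  have "(\<lambda>n. \<phi> (y n)) \<longlonglongrightarrow> \<phi> z" by (intro tendsto_intros z)
  then have \<phi>z: "\<phi> z = 1" by (simp add: y(1) LIMSEQ_const_iff)
  have ker: "inner w z = 0" if "\<phi> w = 0" for w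
  proof (rule ccontr)
    assume neq: "inner w z \<noteq> 0"
    then have w: "inner w w > 0" by auto
    \<comment> \<open>This \<open>t\<close> minimises the norm of z - t w, a vector still on the
      hyperplane; a nonzero inner product would beat the minimal norm.\<close>
    define t where "t = inner w z / inner w w"
    have "\<phi> (z - t *\<^sub>R w) = 1" by (simp add: blinfun.bilinear_simps \<phi>z that)
    from power_mono[OF lower[OF this], of 2] d
    have "inner z z \<le> inner (z - t *\<^sub>R w) (z - t *\<^sub>R w)"
      by (simp add: norm_z[symmetric] power2_norm_eq_inner)
    also have "\<dots> = inner z z - 2 * t * inner w z + t * (t * inner w w)"
      by (simp add: inner_diff_left inner_diff_right inner_commute algebra_simps)
    also have "t * inner w w = inner w z" using w by (simp add: t_def)
    finally have "t * inner w z \<le> 0" by simp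
    moreover have "t * inner w z = (inner w z)\<^sup>2 / inner w w"
      by (simp add: t_def power2_eq_square)
    ultimately show False using neq w by (simp add: divide_le_0_iff)
  qed
  have "\<phi> x = inner x (inverse (d\<^sup>2) *\<^sub>R z)" for x
  proof -
    have "\<phi> (x - \<phi> x *\<^sub>R z) = 0" by (simp add: blinfun.bilinear_simps \<phi>z)
    from ker[OF this] have "inner x z = \<phi> x * d\<^sup>2"
      by (simp add: inner_diff_left norm_z[symmetric] power2_norm_eq_inner)
    then show ?thesis using d by simp
  qed
  then show ?thesis by blast
qed

lemma Im_cinner: "Im (cinner x y) = inner ((- \<i>) *\<^sub>C x) y"
  by (simp add: Re_cinner[symmetric] cinner_scaleC_left)

text \<open>Riesz yields an adjoint for the real inner product only. The imaginary part follows by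
  rotating \<open>x\<close>, since \<open>A\<close> commutes with the rotation.\<close>

lemma cinner_adj_ex:
  fixes A :: "'a::complex_hilbert_space \<Rightarrow>\<^sub>L 'a"
  assumes A: "clinear_op A"
  shows "\<exists>S :: 'a \<Rightarrow>\<^sub>L 'a. \<forall>x y. cinner (A x) y = cinner x (S y)"
proof -
  have "\<exists>z. \<forall>x. inner (A x) y = inner x z" for y
    using riesz_representation[of "blinfun_inner_left y o\<^sub>L A"] by (simp add: inner_commute)
  then obtain R where R: "\<And>x y. inner (A x) y = inner x (R y)" by metis
  have ext: "u = v" if "\<And>x. inner x u = inner x v" for u v :: 'a
    using that by (metis inner_commute vector_eq_ldot)
  have "bounded_linear R"
  proof (rule bounded_linear_intro[where K = "norm A"])
    show "R (x + y) = R x + R y" for x y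
      by (rule ext) (simp add: R[symmetric] inner_add_right)
    show "R (a *\<^sub>R x) = a *\<^sub>R R x" for a x
      by (rule ext) (simp add: R[symmetric])
    show "norm (R x) \<le> norm x * norm A" for x
    proof (cases "R x = 0")
      case False
      have "norm (R x) * norm (R x) = inner (A (R x)) x"
        by (simp add: R power2_norm_eq_inner[symmetric] power2_eq_square)
      also have "\<dots> \<le> norm (A (R x)) * norm x" by (rule norm_cauchy_schwarz)
      also have "\<dots> \<le> norm A * norm (R x) * norm x" by (intro mult_right_mono norm_blinfun) simp
      finally have "norm (R x) * norm (R x) \<le> norm (R x) * (norm x * norm A)"
        by (simp add: ac_simps)
      then show ?thesis using False by simp
    qed simp
  qed
  moreover have "cinner (A x) y = cinner x (R y)" for x y
    by (simp add: complex_eq_iff Re_cinner Im_cinner clinear_opD[OF A, symmetric] R)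
  ultimately show ?thesis
    by (intro exI[of _ "Blinfun R"]) (simp add: bounded_linear_Blinfun_apply)
qed

lemma cinner_ext: "(\<And>x. cinner x u = cinner x v) \<Longrightarrow> u = v"
  by (metis Re_cinner inner_commute vector_eq_ldot)

lemma adj_eqI:
  fixes A S :: "'a::complex_hilbert_space \<Rightarrow>\<^sub>L 'a"
  assumes "\<And>x y. cinner (A x) y = cinner x (S y)"
  shows "adj A = S"
  unfolding adj_def
proof (rule the_equality)
  fix S' :: "'a \<Rightarrow>\<^sub>L 'a"
  assume "\<forall>x y. cinner (A x) y = cinner x (S' y)"
  then show "S' = S" using assms by (metis blinfun_eqI cinner_ext)
qed (use assms in blast)

lemma cinner_adj:
  fixes A :: "'a::complex_hilbert_space \<Rightarrow>\<^sub>L 'a"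
  assumes "clinear_op A"
  shows "cinner (A x) y = cinner x (adj A y)"
proof -
  obtain S :: "'a \<Rightarrow>\<^sub>L 'a" where "\<And>x y. cinner (A x) y = cinner x (S y)"
    using cinner_adj_ex[OF assms] by blast
  then show ?thesis using adj_eqI[of A S] by simp
qed

lemma inner_adj: "clinear_op A \<Longrightarrow> inner (A x) y = inner x (adj A y)"
  by (metis Re_cinner cinner_adj)

lemma clinear_op_adj:
  assumes "clinear_op A"
  shows "clinear_op (adj A)"
  unfolding clinear_op_def
  by (intro allI cinner_ext) (simp add: cinner_adj[OF assms, symmetric] cinner_scaleC_right)

lemma adj_adj: "clinear_op A \<Longrightarrow> adj (adj A) = A"
  by (rule adj_eqI) (metis cinner_adj cinner_commute)

lemma positive_op_adj_compose:
  assumes "clinear_op A"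
  shows "positive_op (adj A o\<^sub>L A)"
  unfolding positive_op_def selfadjoint_def
  using inner_adj[OF assms] assms
  by (simp add: clinear_op_compose clinear_op_adj) (metis inner_adj inner_commute inner_ge_zero)

section \<open>Powers and absolute values\<close>

text \<open>The constant 1 at exponent 0 keeps the function continuous at the origin, so t = 0 and t
  = 1 fall under the same calculus.\<close>

definition powr0 :: "real \<Rightarrow> real \<Rightarrow> real" where
  "powr0 s r = (if s = 0 then 1 else r powr s)"

lemma op_powr_eq_cfc: "op_powr T s = cfc (powr0 s) T"
  by (simp add: op_powr_def powr0_def[abs_def])

lemma powr0_nonneg: "0 \<le> powr0 s r"
  by (simp add: powr0_def)

lemma powr0_add: "0 \<le> s \<Longrightarrow> 0 \<le> t \<Longrightarrow> powr0 s r * powr0 t r = powr0 (s + t) r"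
  by (simp add: powr0_def powr_add)

lemma powr0_1: "0 \<le> r \<Longrightarrow> powr0 1 r = r"
  by (simp add: powr0_def)

lemma continuous_on_powr0: "0 \<le> s \<Longrightarrow> continuous_on {0..} (powr0 s)"
  unfolding powr0_def[abs_def]
  by (cases "s = 0") (simp_all add: continuous_on_powr')

lemma op_powr_add:
  "positive_op T \<Longrightarrow> 0 \<le> s \<Longrightarrow> 0 \<le> t \<Longrightarrow> op_powr T (s + t) = op_powr T s o\<^sub>L op_powr T t"
  using cfc_mult[of T "powr0 s" "powr0 t"]
  by (simp add: op_powr_eq_cfc continuous_on_powr0 powr0_add)

lemma op_powr_1: "positive_op T \<Longrightarrow> op_powr T 1 = T"
  unfolding op_powr_eq_cfc using cfc_cong[of T "powr0 1" "\<lambda>r. r"] by (simp add: powr0_1 cfc_id)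

lemma positive_op_abs: "clinear_op A \<Longrightarrow> positive_op (op_abs A)"
  unfolding op_abs_def op_powr_eq_cfc
  by (intro positive_op_cfc positive_op_adj_compose continuous_on_powr0 powr0_nonneg) auto

lemma op_abs_square: "clinear_op A \<Longrightarrow> op_abs A o\<^sub>L op_abs A = adj A o\<^sub>L A"
  unfolding op_abs_def
  using op_powr_add[OF positive_op_adj_compose, of A "1/2" "1/2"]
  by (simp add: op_powr_1 positive_op_adj_compose)

lemma norm_op_abs:
  assumes A: "clinear_op A"
  shows "norm (op_abs A x) = norm (A x)"
proof -
  have "inner (op_abs A x) (op_abs A x) = inner x ((op_abs A o\<^sub>L op_abs A) x)"
    by (simp add: selfadjointD[OF positive_op_selfadjoint[OF positive_op_abs[OF A]]])
  also have "\<dots> = inner (A x) (A x)"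
    by (simp add: op_abs_square[OF A] inner_adj[OF A])
  finally show ?thesis by (simp add: norm_eq_sqrt_inner)
qed

text \<open>Associativity gives the intertwining of \<open>adj A o\<^sub>L A\<close> and
  \<open>A o\<^sub>L adj A\<close> by \<open>A\<close>; the square root inherits it.\<close>

lemma op_abs_intertwine:
  assumes A: "clinear_op A"
  shows "A o\<^sub>L op_abs A = op_abs (adj A) o\<^sub>L A"
  unfolding op_abs_def op_powr_eq_cfc
proof (rule cfc_intertwine)
  show "A o\<^sub>L (adj A o\<^sub>L A) = (adj (adj A) o\<^sub>L adj A) o\<^sub>L A"
    by (simp add: adj_adj[OF A] compose_assoc)
qed (intro positive_op_adj_compose continuous_on_powr0 clinear_op_adj A; simp)+

section \<open>The mixed Schwarz inequality\<close>

text \<open>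
  Kato's inequality.  The regularisation \<open>k = 1 / (f + \<epsilon>)\<close> replaces the polar decomposition:
  \<open>A = A k(|A|) f(|A|) + O(\<epsilon>)\<close>, and \<open>r k(r) \<le> g(r)\<close>.
\<close>

lemma mixed_schwarz:
  assumes A: "clinear_op A"
    and f: "continuous_on {0..} f" "\<And>r. 0 \<le> r \<Longrightarrow> 0 \<le> f r"
    and g: "continuous_on {0..} g" "\<And>r. 0 \<le> r \<Longrightarrow> 0 \<le> g r"
    and fg: "\<And>r. 0 \<le> r \<Longrightarrow> f r * g r = r"
  shows "\<bar>inner (A u) v\<bar> \<le> norm (cfc f (op_abs A) u) * norm (cfc g (op_abs (adj A)) v)"
proof -
  define T where "T = op_abs A"
  define T' where "T' = op_abs (adj A)"
  have A': "clinear_op (adj A)" using A by (rule clinear_op_adj)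
  have T: "positive_op T" unfolding T_def using A by (rule positive_op_abs)
  have T': "positive_op T'" unfolding T'_def using A' by (rule positive_op_abs)
  \<comment> \<open>Used with p = f r * k r, which lies in [0, 1].\<close>
  have damp: "\<bar>p * q\<bar> \<le> q" if "p \<le> 1" "0 \<le> p" "0 \<le> q" for p q :: real
    using that by (simp add: abs_mult mult_left_le_one_le)
  have cid: "continuous_on {0..} (\<lambda>r::real. r)" by (rule continuous_on_id)
  let ?X = "norm (cfc f T u)" and ?Y = "norm (cfc g T' v)" and ?Z = "norm (cfc g T u) * norm v"
  have approx: "\<bar>inner (A u) v\<bar> \<le> ?X * ?Y + e * ?Z" if "e > 0" for e
  proof -
    define k where "k = (\<lambda>r. inverse (f r + e))"
    have pos: "f r + e > 0" if "r \<ge> 0" for r using f(2)[OF that] \<open>e > 0\<close> by simp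
    have k: "continuous_on {0..} k"
      unfolding k_def using pos by (intro continuous_intros f) force
    \<comment> \<open>The part of \<open>u\<close> lost by the regularisation. Its image under
      \<open>A\<close> has the norm of \<open>T w\<close>, governed by r (1 - k f) = (f k) (e g) <=
      e g.\<close>
    define w where "w = u - cfc k T (cfc f T u)"
    have ckf: "continuous_on {0..} (\<lambda>r. 1 - k r * f r)" by (intro continuous_intros k f)
    have "w = cfc (\<lambda>r. 1 - k r * f r) T u"
      using cfc_diff[OF T continuous_on_const[of _ 1] continuous_on_mult[OF k f(1)]]
      by (simp add: w_def cfc_const[OF T] cfc_mult[OF T k f(1)] blinfun.bilinear_simps)
    then have "T w = cfc (\<lambda>r. r * (1 - k r * f r)) T u"
      by (simp add: cfc_mult[OF T cid ckf] cfc_id[OF T])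
    moreover have "norm (cfc (\<lambda>r. r * (1 - k r * f r)) T u) \<le> norm (cfc (\<lambda>r. e * g r) T u)"
    proof (rule norm_cfc_mono[OF T])
      fix r :: real assume r: "r \<ge> 0"
      have "f r \<le> f r + e" using \<open>e > 0\<close> by simp
      then have "f r * k r \<le> 1" "0 \<le> f r * k r"
        using pos[OF r] f(2)[OF r] by (simp_all add: k_def field_simps)
      moreover have "r * (1 - k r * f r) = (f r * k r) * (e * g r)"
      proof -
        have "1 - k r * f r = e * k r" using pos[OF r] by (simp add: k_def field_simps)
        then show ?thesis using fg[OF r] by (simp add: ac_simps)
      qed
      moreover have "0 \<le> e * g r" using g(2)[OF r] \<open>e > 0\<close> by simp
      ultimately show "\<bar>r * (1 - k r * f r)\<bar> \<le> e * g r"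
        using damp by presburger
    qed (intro continuous_intros k f g)+
    moreover have "norm (cfc (\<lambda>r. e * g r) T u) = e * norm (cfc g T u)"
      using \<open>e > 0\<close> by (simp add: cfc_mult[OF T continuous_on_const g(1)] cfc_const[OF T]
          blinfun.bilinear_simps)
    ultimately have Aw: "norm (A w) \<le> e * norm (cfc g T u)"
      by (simp add: norm_op_abs[OF A, symmetric] T_def)
    have K: "selfadjoint (cfc k T)" by (rule selfadjoint_cfc[OF T k])
    \<comment> \<open>Moves \<open>k\<close> from \<open>T\<close> to \<open>T'\<close> across
      \<open>adj A\<close>. Then \<open>adj A\<close> may be replaced by \<open>T'\<close> inside
      the norm, which leaves the function r k(r), dominated by \<open>g\<close>.\<close>
    have "adj A o\<^sub>L T' = T o\<^sub>L adj A"
      using op_abs_intertwine[OF A'] by (simp add: T_def T'_def adj_adj[OF A])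
    from cfc_intertwine[OF T' T k this]
    have comm: "cfc k T (adj A v) = adj A (cfc k T' v)"
      by (metis blinfun_apply_blinfun_compose)
    have "norm (adj A (cfc k T' v)) = norm (T' (cfc k T' v))"
      by (simp add: norm_op_abs[OF A', symmetric] T'_def)
    also have "T' (cfc k T' v) = cfc (\<lambda>r. r * k r) T' v"
      by (simp add: cfc_mult[OF T' cid k] cfc_id[OF T'])
    also have "norm (cfc (\<lambda>r. r * k r) T' v) \<le> ?Y"
    proof (rule norm_cfc_mono[OF T'])
      fix r :: real assume r: "r \<ge> 0"
      have "f r \<le> f r + e" using \<open>e > 0\<close> by simp
      then have "f r * k r \<le> 1" "0 \<le> f r * k r"
        using pos[OF r] f(2)[OF r] by (simp_all add: k_def field_simps)
      moreover have "r * k r = (f r * k r) * g r" using fg[OF r] by (simp add: ac_simps)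
      ultimately show "\<bar>r * k r\<bar> \<le> g r"
        using damp g(2)[OF r] by presburger
    qed (intro continuous_intros k g)+
    finally have KAv: "norm (cfc k T (adj A v)) \<le> ?Y" using comm by simp
    have "inner (A u) v = inner (A (cfc k T (cfc f T u))) v + inner (A w) v"
      by (simp add: w_def blinfun.bilinear_simps inner_diff_left)
    also have "inner (A (cfc k T (cfc f T u))) v = inner (cfc f T u) (cfc k T (adj A v))"
      by (simp add: inner_adj[OF A] selfadjointD[OF K])
    finally have "\<bar>inner (A u) v\<bar> \<le> \<bar>inner (cfc f T u) (cfc k T (adj A v))\<bar> + \<bar>inner (A w) v\<bar>"
      by simp
    also have "\<dots> \<le> ?X * norm (cfc k T (adj A v)) + norm (A w) * norm v"
      by (intro add_mono Cauchy_Schwarz_ineq2)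
    also have "\<dots> \<le> ?X * ?Y + e * norm (cfc g T u) * norm v"
      by (intro add_mono mult_left_mono mult_right_mono KAv Aw) auto
    finally show ?thesis by (simp add: mult.assoc)
  qed
  show ?thesis
    unfolding T_def[symmetric] T'_def[symmetric]
  proof (rule field_le_epsilon)
    fix d :: real assume "d > 0"
    have Z: "?Z + 1 > 0" by (simp add: add_nonneg_pos)
    then have e: "d / (?Z + 1) > 0" using \<open>d > 0\<close> by simp
    then have "d / (?Z + 1) * ?Z \<le> d / (?Z + 1) * (?Z + 1)" by (intro mult_left_mono) auto
    also have "\<dots> = d" using Z by simp
    finally have "d / (?Z + 1) * ?Z \<le> d" .
    then show "\<bar>inner (A u) v\<bar> \<le> ?X * ?Y + d" using approx[OF e] by linarith
  qed
qed

section \<open>The numerical radius of commutators\<close>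

lemma inner_sum_squares:
  assumes "selfadjoint P" "selfadjoint Q"
  shows "inner (((P o\<^sub>L P) + (Q o\<^sub>L Q)) x) x = (norm (P x))\<^sup>2 + (norm (Q x))\<^sup>2"
  by (simp add: blinfun.bilinear_simps inner_add_left selfadjointD[OF assms(1)]
      selfadjointD[OF assms(2)] power2_norm_eq_inner)

text \<open>
  An operator form of AM-GM: \<open>4 \<langle>P x, Q y\<rangle> = \<parallel>P x + Q y\<parallel>\<^sup>2 - \<parallel>P x - Q y\<parallel>\<^sup>2\<close>, and the
  row operator \<open>(P, Q)\<close> has the norm of its adjoint, whose square is \<open>\<parallel>P\<^sup>2 + Q\<^sup>2\<parallel>\<close>.
\<close>

lemma norm_compose_le_sum_squares:
  assumes P: "selfadjoint P" and Q: "selfadjoint Q"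
  shows "norm (P o\<^sub>L Q) \<le> 1/2 * norm ((P o\<^sub>L P) + (Q o\<^sub>L Q))"
proof -
  define N where "N = norm ((P o\<^sub>L P) + (Q o\<^sub>L Q))"
  have N: "0 \<le> N" by (simp add: N_def)
  have row: "(norm (P x + Q y))\<^sup>2 \<le> N * ((norm x)\<^sup>2 + (norm y)\<^sup>2)" for x y
  proof (cases "P x + Q y = 0")
    case False
    define z where "z = P x + Q y"
    define a where "a = sqrt ((norm x)\<^sup>2 + (norm y)\<^sup>2)"
    define b where "b = sqrt ((norm (P z))\<^sup>2 + (norm (Q z))\<^sup>2)"
    have b: "b\<^sup>2 \<le> N * (norm z)\<^sup>2"
      using inner_apply_le[of "(P o\<^sub>L P) + (Q o\<^sub>L Q)" z]
      by (simp add: b_def N_def inner_sum_squares[OF P Q])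
    have "(norm z)\<^sup>2 = inner x (P z) + inner y (Q z)"
      using selfadjointD[OF P, of x z] selfadjointD[OF Q, of y z]
      by (simp add: z_def power2_norm_eq_inner inner_add_left)
    also have "\<dots> \<le> norm x * norm (P z) + norm y * norm (Q z)"
      by (intro add_mono norm_cauchy_schwarz)
    also have "\<dots> \<le> a * b"
      using Cauchy_Schwarz_ineq2[of "(norm x, norm y)" "(norm (P z), norm (Q z))"]
      by (simp add: a_def b_def norm_Pair)
    finally have "((norm z)\<^sup>2)\<^sup>2 \<le> a\<^sup>2 * b\<^sup>2"
      using power_mono[of "(norm z)\<^sup>2" "a * b" 2] by (simp add: power_mult_distrib)
    also have "\<dots> \<le> a\<^sup>2 * (N * (norm z)\<^sup>2)" by (intro mult_left_mono b) simp
    finally have "(norm z)\<^sup>2 * (norm z)\<^sup>2 \<le> (N * a\<^sup>2) * (norm z)\<^sup>2"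
      by (simp add: power2_eq_square[of "(norm z)\<^sup>2"] ac_simps)
    then have "(norm z)\<^sup>2 \<le> N * a\<^sup>2"
      by (rule mult_right_le_imp_le) (use False in \<open>simp add: z_def\<close>)
    then show ?thesis by (simp add: z_def a_def)
  qed (simp add: N)
  have bound: "inner (P x) (Q y) \<le> 1/2 * N" if "norm x = 1" "norm y = 1" for x y
  proof -
    have "4 * inner (P x) (Q y) = (norm (P x + Q y))\<^sup>2 - (norm (P x - Q y))\<^sup>2"
      unfolding power2_norm_eq_inner by (simp add: inner_simps inner_commute)
    also have "\<dots> \<le> 2 * N" using row[of x y] that by (simp add: algebra_simps add_increasing2)
    finally show ?thesis by simp
  qed
  have "norm (P o\<^sub>L Q) \<le> 1/2 * N"
  proof (rule norm_blinfun_bound)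
    fix y
    show "norm ((P o\<^sub>L Q) y) \<le> 1/2 * N * norm y"
    proof (cases "P (Q y) = 0")
      case False
      then have "y \<noteq> 0" by (auto simp: blinfun.bilinear_simps)
      \<comment> \<open>Moving \<open>P\<close> to the other side pairs P (Q y) with its own
        direction, so this choice attains its norm, up to the factor 1 / norm y.\<close>
      have "inner (P (sgn (P (Q y)))) (Q (sgn y)) \<le> 1/2 * N"
        using False \<open>y \<noteq> 0\<close> by (intro bound) (simp_all add: norm_sgn)
      moreover have "inner (P (sgn (P (Q y)))) (Q (sgn y)) = norm (P (Q y)) / norm y"
        using False by (simp add: selfadjointD[OF P] sgn_div_norm blinfun.bilinear_simps
            power2_norm_eq_inner[symmetric] power2_eq_square field_simps)
      ultimately show ?thesis using \<open>y \<noteq> 0\<close> by (simp add: field_simps)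
    qed (simp add: N)
  qed (simp add: N)
  then show ?thesis by (simp add: N_def)
qed

lemma cmod_cinner_compose_le:
  assumes A: "clinear_op A" and B: "clinear_op B"
    and f: "continuous_on {0..} f" "\<And>r. 0 \<le> r \<Longrightarrow> 0 \<le> f r"
    and g: "continuous_on {0..} g" "\<And>r. 0 \<le> r \<Longrightarrow> 0 \<le> g r"
    and fg: "\<And>r. 0 \<le> r \<Longrightarrow> f r * g r = r"
  defines "F \<equiv> \<lambda>C. cfc f (op_abs C)" and "G \<equiv> \<lambda>C. cfc g (op_abs (adj C))"
  shows "cmod (cinner (A (B x)) x)
    \<le> 1/4 * norm ((F A o\<^sub>L F A) + (G B o\<^sub>L G B)) * norm ((F B o\<^sub>L F B) + (G A o\<^sub>L G A)) * (norm x)\<^sup>2"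
    (is "_ \<le> 1/4 * ?M * ?N * _")
proof -
  have F: "selfadjoint (F C)" and G: "selfadjoint (G C)" if "clinear_op C" for C
    unfolding F_def G_def using that
    by (auto intro!: selfadjoint_cfc positive_op_abs clinear_op_adj f g)
  have FG: "\<bar>inner (C u) v\<bar> \<le> norm (F C u) * norm (G C v)" if "clinear_op C" for C u v
    unfolding F_def G_def by (rule mixed_schwarz[OF that f g fg])
  \<comment> \<open>The squared norm of \<open>z = F A (B x)\<close> is the inner product of
    \<open>B x\<close> and \<open>F A z\<close>. Kato's inequality for \<open>B\<close> applies to
    this pair, and one factor |z| cancels.\<close>
  have FAB: "norm (F A (B x)) \<le> norm (F B x) * (1/2 * ?M)"
  proof (cases "F A (B x) = 0")
    case False
    define z where "z = F A (B x)"
    have "norm z * norm z = inner (B x) (F A z)"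
      using selfadjointD[OF F[OF A], of "B x" z]
      by (simp add: z_def power2_norm_eq_inner[symmetric] power2_eq_square)
    also have "\<dots> \<le> norm (F B x) * norm (G B (F A z))" using FG[OF B, of x "F A z"] by simp
    also have "norm (G B (F A z)) \<le> norm (G B o\<^sub>L F A) * norm z"
      using norm_blinfun[of "G B o\<^sub>L F A" z] by simp
    also have "norm (G B o\<^sub>L F A) \<le> 1/2 * ?M"
      using norm_compose_le_sum_squares[OF G[OF B] F[OF A]] by (simp add: add.commute)
    finally have "norm z * norm z \<le> norm (F B x) * (1/2 * ?M) * norm z"
      by (simp add: mult_left_mono mult_right_mono ac_simps)
    then show ?thesis using False by (simp add: z_def)
  qed simp
  have amgm: "norm (F B x) * norm (G A x) \<le> 1/2 * (?N * (norm x)\<^sup>2)"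
  proof -
    have "2 * (norm (F B x) * norm (G A x)) \<le> (norm (F B x))\<^sup>2 + (norm (G A x))\<^sup>2"
      using sum_squares_bound[of "norm (F B x)" "norm (G A x)"] by simp
    also have "\<dots> \<le> ?N * (norm x)\<^sup>2"
      unfolding inner_sum_squares[OF F[OF B] G[OF A], symmetric] by (rule inner_apply_le)
    finally show ?thesis by simp
  qed
  define z where "z = cinner (A (B x)) x"
  \<comment> \<open>Kato's inequality was proved for real parts. Rotating the second vector by
    \<open>cnj c\<close> turns the real part into the modulus, and \<open>G A\<close> preserves the
    norm of the rotation.\<close>
  obtain c where c: "cmod c = 1" "c * z = complex_of_real (cmod z)"
  proof (cases "z = 0")
    case True
    then show thesis using that[of 1] by simp
  next
    case False
    then show thesis
      using that[of "cnj z / complex_of_real (cmod z)"] complex_norm_square[of z]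
      by (simp add: norm_divide power2_eq_square field_simps)
  qed
  have "cmod z = Re (c * z)" using c by simp
  also have "\<dots> = inner (A (B x)) (cnj c *\<^sub>C x)"
    by (simp add: z_def Re_cinner[symmetric] cinner_scaleC_right)
  also have "\<dots> \<le> norm (F A (B x)) * norm (G A (cnj c *\<^sub>C x))"
    using FG[OF A, of "B x" "cnj c *\<^sub>C x"] by simp
  also have "norm (G A (cnj c *\<^sub>C x)) = norm (G A x)"
    using c(1) by (simp add: clinear_opD[OF selfadjoint_clinear[OF G[OF A]]] norm_scaleC)
  also have "norm (F A (B x)) * norm (G A x) \<le> norm (F B x) * (1/2 * ?M) * norm (G A x)"
    by (intro mult_right_mono FAB) simp
  also have "\<dots> = 1/2 * ?M * (norm (F B x) * norm (G A x))" by simp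
  also have "\<dots> \<le> 1/2 * ?M * (1/2 * (?N * (norm x)\<^sup>2))" by (intro mult_left_mono amgm) simp
  finally show ?thesis by (simp add: z_def mult.assoc)
qed

lemma numerical_radius_le:
  fixes T :: "'a::complex_hilbert_space \<Rightarrow>\<^sub>L 'a"
  assumes "c \<ge> 0" "\<And>x. norm x = 1 \<Longrightarrow> cmod (cinner (T x) x) \<le> c"
  shows "numerical_radius T \<le> c"
  using assms by (auto simp: numerical_radius_def intro!: cSUP_least)

lemma numerical_radius_commutator_le:
  assumes A: "clinear_op A" and B: "clinear_op B" and t: "t \<in> {0..1}"
  defines "c \<equiv> 1/2 * norm (op_powr (op_abs A) (2*t) + op_powr (op_abs (adj B)) (2*(1-t)))
            * norm (op_powr (op_abs B) (2*t) + op_powr (op_abs (adj A)) (2*(1-t)))"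
  shows "numerical_radius ((A o\<^sub>L B) + (B o\<^sub>L A)) \<le> c"
    and "numerical_radius ((A o\<^sub>L B) - (B o\<^sub>L A)) \<le> c"
proof -
  have t0: "0 \<le> t" "0 \<le> 1 - t" using t by auto
  \<comment> \<open>The bound contains squares of the operators in Kato's inequality, which doubles
    the exponents.\<close>
  have double: "op_powr (op_abs C) (2 * s) = cfc (powr0 s) (op_abs C) o\<^sub>L cfc (powr0 s) (op_abs C)"
    if "clinear_op C" "0 \<le> s" for C s
    using op_powr_add[OF positive_op_abs[OF that(1)] that(2) that(2)]
    unfolding op_powr_eq_cfc mult_2 .
  have pq: "powr0 t r * powr0 (1 - t) r = r" if "0 \<le> r" for r
    using powr0_add[OF t0] powr0_1[OF that] by simp
  have le: "cmod (cinner (C (D x)) x)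
      \<le> 1/4 * norm (op_powr (op_abs C) (2*t) + op_powr (op_abs (adj D)) (2*(1-t)))
            * norm (op_powr (op_abs D) (2*t) + op_powr (op_abs (adj C)) (2*(1-t)))"
    if "clinear_op C" "clinear_op D" "norm x = 1" for C D x
    using cmod_cinner_compose_le[OF that(1,2) continuous_on_powr0[OF t0(1)] powr0_nonneg
        continuous_on_powr0[OF t0(2)] powr0_nonneg pq, of x] that(3)
    unfolding double[OF that(1) t0(1)] double[OF that(2) t0(1)]
      double[OF clinear_op_adj[OF that(1)] t0(2)] double[OF clinear_op_adj[OF that(2)] t0(2)]
    by simp
  have sum: "cmod (cinner (A (B x)) x) + cmod (cinner (B (A x)) x) \<le> c" if "norm x = 1" for x
    using le[OF A B that] le[OF B A that] by (simp add: c_def mult.commute)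
  have "c \<ge> 0" by (simp add: c_def)
  show "numerical_radius ((A o\<^sub>L B) + (B o\<^sub>L A)) \<le> c"
  proof (rule numerical_radius_le[OF \<open>c \<ge> 0\<close>])
    fix x :: 'a assume "norm x = 1"
    then show "cmod (cinner (((A o\<^sub>L B) + (B o\<^sub>L A)) x) x) \<le> c"
      using sum norm_triangle_ineq[of "cinner (A (B x)) x" "cinner (B (A x)) x"]
      by (fastforce simp: blinfun.bilinear_simps cinner_add_left)
  qed
  show "numerical_radius ((A o\<^sub>L B) - (B o\<^sub>L A)) \<le> c"
  proof (rule numerical_radius_le[OF \<open>c \<ge> 0\<close>])
    fix x :: 'a assume "norm x = 1"
    moreover have "cinner (u - v) x = cinner u x - cinner v x" for u v
      using cinner_add_left[of "u - v" v x] by simp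
    ultimately show "cmod (cinner (((A o\<^sub>L B) - (B o\<^sub>L A)) x) x) \<le> c"
      using sum norm_triangle_ineq4[of "cinner (A (B x)) x" "cinner (B (A x)) x"]
      by (fastforce simp: blinfun.bilinear_simps)
  qed
qed

theorem corollary2p9:
  fixes A B :: "'a::complex_hilbert_space \<Rightarrow>\<^sub>L 'a"
  assumes "clinear_op A" and "clinear_op B"
  shows "(\<forall>t\<in>{0..1::real}.
      numerical_radius ((A o\<^sub>L B) + (B o\<^sub>L A)) \<le>
        1/2 * norm (op_powr (op_abs A) (2*t) + op_powr (op_abs (adj B)) (2*(1-t)))
            * norm (op_powr (op_abs B) (2*t) + op_powr (op_abs (adj A)) (2*(1-t))) \<and>
      numerical_radius ((A o\<^sub>L B) - (B o\<^sub>L A)) \<le>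
        1/2 * norm (op_powr (op_abs A) (2*t) + op_powr (op_abs (adj B)) (2*(1-t)))
            * norm (op_powr (op_abs B) (2*t) + op_powr (op_abs (adj A)) (2*(1-t)))) \<and>
    numerical_radius ((A o\<^sub>L B) + (B o\<^sub>L A)) \<le>
        1/2 * norm (op_abs A + op_abs (adj B)) * norm (op_abs B + op_abs (adj A)) \<and>
    numerical_radius ((A o\<^sub>L B) - (B o\<^sub>L A)) \<le>
        1/2 * norm (op_abs A + op_abs (adj B)) * norm (op_abs B + op_abs (adj A))"
proof -
  \<comment> \<open>At t = 1/2 both exponents equal 1.\<close>
  have "op_powr (op_abs C) 1 = op_abs C" if "clinear_op C" for C :: "'a \<Rightarrow>\<^sub>L 'a"
    by (rule op_powr_1[OF positive_op_abs[OF that]])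
  then show ?thesis
    using numerical_radius_commutator_le[OF assms]
      numerical_radius_commutator_le[OF assms, of "1/2"]
    by (simp add: assms clinear_op_adj)
qed

end
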